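(* Fix real numbers $\varphi_0<\varphi_1$, let $\varepsilon\in(0,\varepsilon_0)$ with $\varepsilon_0=1/(\varphi_1-\varphi_0)$, and let $\rho\in M$. Then any minimizer of $\mathcal G_\varepsilon(\rho,\cdot)$ over $\mathcal F$ is a fixed point of $K_{\rho,\varepsilon}$, i.e. $$\mathscr F_\varepsilon(\rho)\subset \mathscr P_\varepsilon(\rho).$$ Moreover, the functional $S_\varepsilon$ is lower semicontinuous on $M$ (for the weak* topology). Finally, if a sequence $\{\rho^n\}\subset M$ converges to $\rho$ strongly in $L^1([0,1])$, then $S_\varepsilon(\rho^n)\to S_\varepsilon(\rho)$.
   Context: $M=\{\rho\in L^\infty([0,1]):0\le\rho\le1\}$ with the relative weak* topology of $L^\infty=(L^1)^*$. $\mathcal F$ is the set of functions $\varphi:[0,1]\to\mathbb R$ of the form $\varphi(x)=\varphi_0+\mu([0,x])$ with $\mu$ a positive Borel measure on $[0,1]$ of total mass $\varphi_1-\varphi_0$; $\mu$ is denoted $d\varphi$, and $\mathcal F$ carries the topology of weak convergence of the measures $d\varphi$. $s(a)=a\log a+(1-a)\log(1-a)$ for $a\in[0,1]$ (with $0\log0=0$), $s(a)=+\infty$ otherwise. $\mathcal G_\varepsilon:M\times\mathcal F\to(-\infty,+\infty]$ is $$\mathcal G_\varepsilon(\rho,\varphi)=\int_0^1\big[s(\rho)+s(\varepsilon\varphi_x)+(1-\rho)\varphi-\log(1+e^\varphi)\big]dx,$$ with $\mathcal G_\varepsilon(\rho,\varphi)=+\infty$ unless $d\varphi$ is absolutely continuous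 with respect to Lebesgue measure with density $\varphi_x$ bounded by $\varepsilon^{-1}$. $\mathscr F_\varepsilon(\rho)\subset\mathcal F$ is the set of minimizers of $\mathcal G_\varepsilon(\rho,\cdot)$ over $\mathcal F$. For $\rho\in M$, $K_{\rho,\varepsilon}:\mathcal F\to\mathcal F$ is $$(K_{\rho,\varepsilon}\varphi)(x)=\varphi_0+\frac1\varepsilon\int_0^x\frac{A\exp\{\frac1\varepsilon\int_0^y[(1+e^{\varphi})^{-1}-\rho]dz\}}{1+A\exp\{\frac1\varepsilon\int_0^y[(1+e^{\varphi})^{-1}-\rho]dz\}}\,dy,$$ where $A=A(\varepsilon,\rho,\varphi)\in(0,\infty)$ is the unique number such that $(K_{\rho,\varepsilon}\varphi)(1)=\varphi_1$. $\mathscr P_\varepsilon(\rho)$ is the set of fixed points of $K_{\rho,\varepsilon}$ in $\mathcal F$. $\rho_i\in(0,1)$ is defined by $\varphi_i=\log[\rho_i/(1-\rho_i)]$, $i=0,1$; $f(a)=a(1-a)$. $\bar\rho_\varepsilon$ is the stationary solution of the viscous Burgers equation: with $J_\varepsilon$ the unique number in $(-\infty,\min_{[\rho_0,\rho_1]}f)$ with $\int_{\rho_0}^{\rho_1}\frac{\varepsilon}{f(r)-J_\varepsilon}dr=1$, $\bar\rho_\varepsilon$ solves $f(\bar\rho_\varepsilon)-\varepsilon(\bar\rho_\varepsilon)_x=J_\varepsilon$ on $[0,1]$, $\bar\rho_\varepsilon(0)=\rho_0$ (so $\bar\rho_\varepsilon(1)=\rho_1$). $S^o_\varepsilon(\rho)=\inf\{\mathcal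 G_\varepsilon(\rho,\varphi):\varphi\in\mathcal F\}$ and $S_\varepsilon(\rho)=S^o_\varepsilon(\rho)-S^o_\varepsilon(\bar\rho_\varepsilon)$ for $\rho\in M$. *)

theory Defs
  imports "HOL-Analysis.Analysis"
begin

text \<open>
  Elements of \<open>L\<^sup>1([0,1])\<close> and \<open>L\<^sup>\<infinity>([0,1])\<close> are represented by Lebesgue measurable functions on
  \<open>[0,1]\<close>; values outside \<open>[0,1]\<close> and on null sets are irrelevant. The weak* topology below does
  not separate two representatives of the same class, so its open sets are exactly the preimages
  of the open sets of the quotient.
\<close>

definition L1_space :: "(real \<Rightarrow> real) set" where
  "L1_space = {g. integrable (lebesgue_on {0..1}) g}"

definition Linf_space :: "(real \<Rightarrow> real) set" where
  "Linf_space = {\<rho> \<in> borel_measurable (lebesgue_on {0..1}).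
     \<exists>C. AE x in lebesgue_on {0..1}. \<bar>\<rho> x\<bar> \<le> C}"

text \<open>The coarsest topology for which all the functionals \<open>\<rho> \<mapsto> \<integral> \<rho> g\<close> with \<open>g \<in> L\<^sup>1\<close> are continuous.\<close>

definition weak_star :: "(real \<Rightarrow> real) topology" where
  "weak_star = pullback_topology Linf_space
     (\<lambda>\<rho>. \<lambda>g\<in>L1_space. LINT x|lebesgue_on {0..1}. \<rho> x * g x)
     (product_topology (\<lambda>_. euclideanreal) L1_space)"

definition M_space :: "(real \<Rightarrow> real) set" where
  "M_space = {\<rho> \<in> Linf_space. AE x in lebesgue_on {0..1}. 0 \<le> \<rho> x \<and> \<rho> x \<le> 1}"

definition M_topology :: "(real \<Rightarrow> real) topology" where
  "M_topology = subtopology weak_star M_space"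

definition lower_semicontinuous_map :: "'a topology \<Rightarrow> ('a \<Rightarrow> ereal) \<Rightarrow> bool" where
  "lower_semicontinuous_map X F \<longleftrightarrow> (\<forall>c. openin X {x \<in> topspace X. c < F x})"

definition represents :: "real \<Rightarrow> real \<Rightarrow> real measure \<Rightarrow> (real \<Rightarrow> real) \<Rightarrow> bool" where
  "represents \<phi>\<^sub>0 \<phi>\<^sub>1 \<mu> \<phi> \<longleftrightarrow>
     sets \<mu> = sets (restrict_space borel {0..1}) \<and>
     emeasure \<mu> {0..1} = ennreal (\<phi>\<^sub>1 - \<phi>\<^sub>0) \<and>
     (\<forall>x\<in>{0..1}. \<phi> x = \<phi>\<^sub>0 + measure \<mu> {0..x})"

text \<open>Functions on \<open>[0,1]\<close> are extensional, so that equality in \<open>\<F>\<close> is equality on \<open>[0,1]\<close>.\<close>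

definition F_space :: "real \<Rightarrow> real \<Rightarrow> (real \<Rightarrow> real) set" where
  "F_space \<phi>\<^sub>0 \<phi>\<^sub>1 = {\<phi> \<in> extensional {0..1}. \<exists>\<mu>. represents \<phi>\<^sub>0 \<phi>\<^sub>1 \<mu> \<phi>}"

text \<open>The measure \<open>d\<phi>\<close>; it is determined by its values on the \<open>\<pi>\<close>-system of intervals \<open>[0,x]\<close>.\<close>

definition d_measure :: "real \<Rightarrow> real \<Rightarrow> (real \<Rightarrow> real) \<Rightarrow> real measure" where
  "d_measure \<phi>\<^sub>0 \<phi>\<^sub>1 \<phi> = (THE \<mu>. represents \<phi>\<^sub>0 \<phi>\<^sub>1 \<mu> \<phi>)"

definition unit_lborel :: "real measure" where
  "unit_lborel = restrict_space lborel {0..1}"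

definition d_density :: "real \<Rightarrow> real \<Rightarrow> (real \<Rightarrow> real) \<Rightarrow> real \<Rightarrow> ennreal" where
  "d_density \<phi>\<^sub>0 \<phi>\<^sub>1 \<phi> = RN_deriv unit_lborel (d_measure \<phi>\<^sub>0 \<phi>\<^sub>1 \<phi>)"

definition s_entropy :: "real \<Rightarrow> ereal" where
  "s_entropy a = (if 0 \<le> a \<and> a \<le> 1 then ereal (a * ln a + (1 - a) * ln (1 - a)) else \<infinity>)"

text \<open>
  In the finite case, for \<open>\<rho> \<in> M\<close>, both arguments of \<open>s_entropy\<close> lie in \<open>[0,1]\<close> almost everywhere, so the
  conversion to real numbers only discards the value \<open>\<infinity>\<close> on a null set.
\<close>

definition G_functional ::
    "real \<Rightarrow> real \<Rightarrow> real \<Rightarrow> (real \<Rightarrow> real) \<Rightarrow> (real \<Rightarrow> real) \<Rightarrow> ereal" where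
  "G_functional \<phi>\<^sub>0 \<phi>\<^sub>1 \<epsilon> \<rho> \<phi> =
    (if absolutely_continuous unit_lborel (d_measure \<phi>\<^sub>0 \<phi>\<^sub>1 \<phi>) \<and>
        (AE x in unit_lborel. d_density \<phi>\<^sub>0 \<phi>\<^sub>1 \<phi> x \<le> ennreal (1 / \<epsilon>))
     then ereal (LINT x|lebesgue_on {0..1}.
            real_of_ereal (s_entropy (\<rho> x)) +
            real_of_ereal (s_entropy (\<epsilon> * enn2real (d_density \<phi>\<^sub>0 \<phi>\<^sub>1 \<phi> x))) +
            (1 - \<rho> x) * \<phi> x - ln (1 + exp (\<phi> x)))
     else \<infinity>)"

definition minimizers :: "real \<Rightarrow> real \<Rightarrow> real \<Rightarrow> (real \<Rightarrow> real) \<Rightarrow> (real \<Rightarrow> real) set" where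
  "minimizers \<phi>\<^sub>0 \<phi>\<^sub>1 \<epsilon> \<rho> =
    {\<phi> \<in> F_space \<phi>\<^sub>0 \<phi>\<^sub>1. \<forall>\<psi>\<in>F_space \<phi>\<^sub>0 \<phi>\<^sub>1.
       G_functional \<phi>\<^sub>0 \<phi>\<^sub>1 \<epsilon> \<rho> \<phi> \<le> G_functional \<phi>\<^sub>0 \<phi>\<^sub>1 \<epsilon> \<rho> \<psi>}"

definition K_exp :: "real \<Rightarrow> (real \<Rightarrow> real) \<Rightarrow> (real \<Rightarrow> real) \<Rightarrow> real \<Rightarrow> real" where
  "K_exp \<epsilon> \<rho> \<phi> y = exp (1 / \<epsilon> * (LINT z:{0..y}|lebesgue. 1 / (1 + exp (\<phi> z)) - \<rho> z))"

definition K_with ::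
    "real \<Rightarrow> real \<Rightarrow> (real \<Rightarrow> real) \<Rightarrow> (real \<Rightarrow> real) \<Rightarrow> real \<Rightarrow> real \<Rightarrow> real" where
  "K_with \<phi>\<^sub>0 \<epsilon> \<rho> \<phi> A x =
     \<phi>\<^sub>0 + 1 / \<epsilon> * (LINT y:{0..x}|lebesgue. A * K_exp \<epsilon> \<rho> \<phi> y / (1 + A * K_exp \<epsilon> \<rho> \<phi> y))"

definition K_const :: "real \<Rightarrow> real \<Rightarrow> real \<Rightarrow> (real \<Rightarrow> real) \<Rightarrow> (real \<Rightarrow> real) \<Rightarrow> real" where
  "K_const \<phi>\<^sub>0 \<phi>\<^sub>1 \<epsilon> \<rho> \<phi> = (THE A. 0 < A \<and> K_with \<phi>\<^sub>0 \<epsilon> \<rho> \<phi> A 1 = \<phi>\<^sub>1)"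

definition K_map ::
    "real \<Rightarrow> real \<Rightarrow> real \<Rightarrow> (real \<Rightarrow> real) \<Rightarrow> (real \<Rightarrow> real) \<Rightarrow> real \<Rightarrow> real" where
  "K_map \<phi>\<^sub>0 \<phi>\<^sub>1 \<epsilon> \<rho> \<phi> = (\<lambda>x\<in>{0..1}. K_with \<phi>\<^sub>0 \<epsilon> \<rho> \<phi> (K_const \<phi>\<^sub>0 \<phi>\<^sub>1 \<epsilon> \<rho> \<phi>) x)"

definition fixed_points :: "real \<Rightarrow> real \<Rightarrow> real \<Rightarrow> (real \<Rightarrow> real) \<Rightarrow> (real \<Rightarrow> real) set" where
  "fixed_points \<phi>\<^sub>0 \<phi>\<^sub>1 \<epsilon> \<rho> = {\<phi> \<in> F_space \<phi>\<^sub>0 \<phi>\<^sub>1. K_map \<phi>\<^sub>0 \<phi>\<^sub>1 \<epsilon> \<rho> \<phi> = \<phi>}"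

definition bdry_density :: "real \<Rightarrow> real" where
  "bdry_density \<phi>\<^sub>i = (THE r. 0 < r \<and> r < 1 \<and> \<phi>\<^sub>i = ln (r / (1 - r)))"

definition flux :: "real \<Rightarrow> real" where
  "flux a = a * (1 - a)"

definition J_const :: "real \<Rightarrow> real \<Rightarrow> real \<Rightarrow> real" where
  "J_const \<phi>\<^sub>0 \<phi>\<^sub>1 \<epsilon> =
    (THE J. J < (INF r\<in>{bdry_density \<phi>\<^sub>0..bdry_density \<phi>\<^sub>1}. flux r) \<and>
            (LINT r:{bdry_density \<phi>\<^sub>0..bdry_density \<phi>\<^sub>1}|lebesgue. \<epsilon> / (flux r - J)) = 1)"

definition rho_bar :: "real \<Rightarrow> real \<Rightarrow> real \<Rightarrow> real \<Rightarrow> real" where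
  "rho_bar \<phi>\<^sub>0 \<phi>\<^sub>1 \<epsilon> =
    (THE u. u \<in> extensional {0..1} \<and> u 0 = bdry_density \<phi>\<^sub>0 \<and>
       (\<forall>x\<in>{0..1}. \<exists>u'. (u has_real_derivative u') (at x within {0..1}) \<and>
          flux (u x) - \<epsilon> * u' = J_const \<phi>\<^sub>0 \<phi>\<^sub>1 \<epsilon>))"

definition So_functional :: "real \<Rightarrow> real \<Rightarrow> real \<Rightarrow> (real \<Rightarrow> real) \<Rightarrow> ereal" where
  "So_functional \<phi>\<^sub>0 \<phi>\<^sub>1 \<epsilon> \<rho> = (INF \<phi>\<in>F_space \<phi>\<^sub>0 \<phi>\<^sub>1. G_functional \<phi>\<^sub>0 \<phi>\<^sub>1 \<epsilon> \<rho> \<phi>)"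

definition S_functional :: "real \<Rightarrow> real \<Rightarrow> real \<Rightarrow> (real \<Rightarrow> real) \<Rightarrow> ereal" where
  "S_functional \<phi>\<^sub>0 \<phi>\<^sub>1 \<epsilon> \<rho> =
     So_functional \<phi>\<^sub>0 \<phi>\<^sub>1 \<epsilon> \<rho> - So_functional \<phi>\<^sub>0 \<phi>\<^sub>1 \<epsilon> (rho_bar \<phi>\<^sub>0 \<phi>\<^sub>1 \<epsilon>)"

end

theory Submission
  imports Defs "HOL-Real_Asymp.Real_Asymp"
begin

text \<open>
  Put \<open>u = \<epsilon> \<phi>\<^sub>x\<close>. If \<open>\<phi>\<close> minimizes, compare it with \<open>K\<phi>\<close>, for which \<open>w = \<epsilon> (K\<phi>)\<^sub>x\<close> satisfies
  \<open>s'(w) = log A + (1/\<epsilon>) \<integral>\<^sub>0\<^sup>x [(1 + e\<^sup>\<phi>)\<^sup>-\<^sup>1 - \<rho>]\<close>. The part of the functional depending on \<open>\<phi>\<close> itself is concave,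
  so it lies below its linearization at \<open>\<phi>\<close>; integrating this by parts gives
  \<open>0 \<le> G(\<rho>, K\<phi>) - G(\<rho>, \<phi>) \<le> - \<integral> [s(u) - s(w) - s'(w) (u - w)]\<close>, and strict convexity of \<open>s\<close> forces \<open>u = w\<close>.
  No first variation at \<open>\<phi>\<close>, where \<open>s'(u)\<close> may be infinite, is needed.

  For the dependence on \<open>\<rho>\<close>, truncating the tangent of \<open>s\<close> at \<open>\<delta>\<close> and \<open>1 - \<delta>\<close> bounds \<open>\<integral> s(\<sigma>) - \<integral> s(\<rho>)\<close> from below by
  \<open>s(\<delta>)\<close>, which tends to 0, plus a functional of \<open>\<sigma> - \<rho>\<close> with a bounded kernel. The remaining term \<open>\<integral> (\<sigma> - \<rho>) \<phi>\<close> is,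
  again by parts, controlled uniformly in \<open>\<phi>\<close> by the supremum of the 1-Lipschitz function \<open>\<integral>\<^sub>0\<^sup>x (\<sigma> - \<rho>)\<close>, hence
  by its values at finitely many points.
\<close>

subsection \<open>Representing measures and the binary entropy\<close>


text \<open>The values of \<phi> fix the measure on the traces of the half-lines
  \<open>{..x}\<close>, a \<pi>-system that generates the Borel sets of [0,1], and the total mass is
  finite. This gives the \<open>THE\<close> in \<open>d_measure\<close> its meaning.\<close>

lemma represents_unique:
  assumes "represents \<phi>\<^sub>0 \<phi>\<^sub>1 \<mu> \<phi>" and "represents \<phi>\<^sub>0 \<phi>\<^sub>1 \<nu> \<phi>"
  shows "\<mu> = \<nu>"
proof (rule measure_eqI_generator_eq)
  let ?E = "(\<inter>) {0..1::real} ` range atMost"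
  have gen: "sets (restrict_space borel {0..1::real}) = sigma_sets {0..1} ?E"
  proof -
    have "sets (borel :: real measure) = sigma_sets UNIV (range atMost)"
      by (subst borel_eq_atMost) simp
    moreover have "{0..1::real} \<in> sigma_sets UNIV (range atMost)"
      by (metis atLeastAtMost_borel calculation)
    ultimately show ?thesis by (simp add: sets_restrict_space sigma_sets_Int)
  qed
  have sets: "sets \<mu> = sets (restrict_space borel {0..1})" "sets \<nu> = sets (restrict_space borel {0..1})"
    using assms by (auto simp: represents_def)
  show "Int_stable ?E"
  proof (rule Int_stableI)
    fix a b assume "a \<in> ?E" "b \<in> ?E"
    then obtain x y where "a = {0..1} \<inter> {..x}" "b = {0..1} \<inter> {..y}" by blast
    then have "a \<inter> b = {0..1} \<inter> {..min x y}" by auto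
    then show "a \<inter> b \<in> ?E" by blast
  qed
  show "?E \<subseteq> Pow {0..1}" by auto
  show "sets \<mu> = sigma_sets {0..1} ?E" "sets \<nu> = sigma_sets {0..1} ?E" using sets gen by auto
  \<comment> \<open>\<open>measure\<close> turns an infinite value into 0, so finiteness, inherited
    from the total mass, has to be established before passing back to
    \<open>emeasure\<close>.\<close>
  have em: "emeasure M {0..x} = ennreal (\<phi> x - \<phi>\<^sub>0)"
    if "represents \<phi>\<^sub>0 \<phi>\<^sub>1 M \<phi>" "x \<in> {0..1}" for M x
  proof -
    have s: "sets M = sets (restrict_space borel {0..1})" using that by (simp add: represents_def)
    have "{0..1} \<in> sets M" "{0..x} \<in> sets M"
      unfolding s using that(2) by (auto simp: sets_restrict_space_iff)
    then have "emeasure M {0..x} \<le> emeasure M {0..1}" using that(2) by (intro emeasure_mono) auto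
    then have "emeasure M {0..x} \<noteq> \<infinity>"
      using that(1) unfolding represents_def by (metis ennreal_neq_top infinity_ennreal_def neq_top_trans)
    then have "emeasure M {0..x} = ennreal (measure M {0..x})"
      by (simp add: emeasure_eq_ennreal_measure)
    then show ?thesis using that by (simp add: represents_def)
  qed
  fix X assume "X \<in> ?E"
  then obtain x where X: "X = {0..1} \<inter> {..x}" by blast
  consider "x < 0" | "0 \<le> x" "x \<le> 1" | "x > 1" by linarith
  then show "emeasure \<mu> X = emeasure \<nu> X"
  proof cases
    case 1
    then have "X = {}" using X by auto
    then show ?thesis by simp
  next
    case 2
    have "X = {0..x}" using X 2 by auto
    then show ?thesis using em[OF assms(1)] em[OF assms(2)] 2 by simp
  next
    case 3
    then have "X = {0..1}" using X by auto
    then show ?thesis using assms by (simp add: represents_def)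
  qed
next
  show "range (\<lambda>n::nat. {0..1::real}) \<subseteq> (\<inter>) {0..1} ` range atMost"
    by (auto intro!: image_eqI[of _ _ "{..1}"])
  show "(\<Union>n::nat. {0..1::real}) = {0..1}" by simp
  show "emeasure \<mu> {0..1} \<noteq> \<infinity>" using assms by (simp add: represents_def)
qed

lemma d_measure_eq:
  assumes "represents \<phi>\<^sub>0 \<phi>\<^sub>1 \<mu> \<phi>"
  shows "d_measure \<phi>\<^sub>0 \<phi>\<^sub>1 \<phi> = \<mu>"
  unfolding d_measure_def using assms represents_unique by blast

text \<open>Real-valued form of \<open>s_entropy\<close>, meant for arguments in [0,1]. The
  convention 0 log 0 = 0 is automatic, since the factor 0 annihilates the product.\<close>

definition entropy :: "real \<Rightarrow> real" where
  "entropy a = a * ln a + (1 - a) * ln (1 - a)"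

text \<open>The gap is the relative entropy of the Bernoulli laws with parameters a and b. It is
  positive by x log(y/x) \<le> y - x, applied to (a, b), where it is strict, and to (1 - a, 1 - b).
  The endpoints a = 0 and a = 1 are included because the density of a minimizer might reach
  them.\<close>

lemma entropy_tangent_strict:
  assumes "0 \<le> a" "a \<le> 1" "0 < b" "b < 1" "a \<noteq> b"
  shows "entropy b + (ln b - ln (1 - b)) * (a - b) < entropy a"
proof -
  have *: "x * ln y - x * ln x \<le> y - x" "x \<noteq> y \<Longrightarrow> x * ln y - x * ln x < y - x" if "0 \<le> x" "0 < y" for x y :: real
  proof -
    have "x * ln y - x * ln x < y - x" if "x \<noteq> y"
    proof (cases "x = 0")
      case False
      then have "0 < x" using \<open>0 \<le> x\<close> by simp
      then have "ln (y / x) < y / x - 1"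
        using ln_le_minus_one[of "y/x"] ln_eq_minus_one[of "y/x"] \<open>0 < y\<close> \<open>x \<noteq> y\<close>
        by (force simp: less_le)
      then have "x * ln (y / x) < x * (y / x - 1)" using \<open>0 < x\<close> by simp
      then show ?thesis using \<open>0 < x\<close> \<open>0 < y\<close> by (simp add: ln_div algebra_simps)
    qed (use \<open>0 < y\<close> in simp)
    then show "x \<noteq> y \<Longrightarrow> x * ln y - x * ln x < y - x" "x * ln y - x * ln x \<le> y - x" by fastforce+
  qed
  show ?thesis
    using *(2)[of a b] *(1)[of "1 - a" "1 - b"] assms
    unfolding entropy_def by (simp add: algebra_simps)
qed

lemma entropy_tangent:
  assumes "0 \<le> a" "a \<le> 1" "0 < b" "b < 1"
  shows "entropy b + (ln b - ln (1 - b)) * (a - b) \<le> entropy a"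
  using entropy_tangent_strict[OF assms] by (cases "a = b") auto

lemma entropy_le_0: "0 \<le> a \<Longrightarrow> a \<le> 1 \<Longrightarrow> entropy a \<le> 0"
proof -
  assume a: "0 \<le> a" "a \<le> 1"
  have "x * ln x \<le> 0" if "0 \<le> x" "x \<le> 1" for x :: real
    using that by (cases "x = 0") (auto simp: mult_nonneg_nonpos)
  from this[of a] this[of "1 - a"] a show ?thesis by (simp add: entropy_def)
qed

text \<open>The tangent at 1/2 is horizontal, at height -log 2.\<close>

lemma entropy_ge: "0 \<le> a \<Longrightarrow> a \<le> 1 \<Longrightarrow> - ln 2 \<le> entropy a"
  using entropy_tangent[of a "1/2"] by (simp add: entropy_def ln_div)

lemma abs_entropy_le: "0 \<le> a \<Longrightarrow> a \<le> 1 \<Longrightarrow> \<bar>entropy a\<bar> \<le> ln 2"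
  using entropy_ge[of a] entropy_le_0[of a] by linarith

text \<open>The derivative s' of the entropy at the point of [\<delta>, 1 - \<delta>] nearest to a.
  Being bounded, unlike s' itself, it can serve as an L1 test function.\<close>

definition clamp_logit :: "real \<Rightarrow> real \<Rightarrow> real" where
  "clamp_logit \<delta> a = (let c = max \<delta> (min (1 - \<delta>) a) in ln c - ln (1 - c))"

lemma abs_clamp_logit_le:
  assumes "0 < \<delta>" "\<delta> < 1/2"
  shows "\<bar>clamp_logit \<delta> a\<bar> \<le> ln (1 - \<delta>) - ln \<delta>"
proof -
  define c where "c = max \<delta> (min (1 - \<delta>) a)"
  have "\<delta> \<le> c" "c \<le> 1 - \<delta>" using assms by (auto simp: c_def)
  then have "ln \<delta> \<le> ln c" "ln c \<le> ln (1 - \<delta>)" "ln \<delta> \<le> ln (1 - c)" "ln (1 - c) \<le> ln (1 - \<delta>)"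
    using assms by auto
  then show ?thesis by (simp add: clamp_logit_def Let_def flip: c_def)
qed

text \<open>Take the tangent at the clamped point c. Either c = a, or c is \<delta> or 1 - \<delta>,
  where the entropy equals s(\<delta>) while s(a) \<le> 0; so s(a) + s(\<delta>) \<le> s(c) in each
  case. Replacing r - c by r - a is harmless: clamping moves a towards 1/2, where s' vanishes, so
  s'(c) (a - c) \<ge> 0.\<close>

lemma entropy_clamp_tangent:
  assumes "0 < \<delta>" "\<delta> < 1/2" "0 \<le> a" "a \<le> 1" "0 \<le> r" "r \<le> 1"
  shows "entropy a + entropy \<delta> + clamp_logit \<delta> a * (r - a) \<le> entropy r"
proof -
  define c where "c = max \<delta> (min (1 - \<delta>) a)"
  have c: "0 < c" "c < 1" using assms by (auto simp: c_def)
  have sym: "entropy (1 - \<delta>) = entropy \<delta>" by (simp add: entropy_def)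
  have sd: "entropy \<delta> \<le> 0" and sa: "entropy a \<le> 0" using assms by (auto intro!: entropy_le_0)
  have "entropy a + entropy \<delta> \<le> entropy c \<and> 0 \<le> (ln c - ln (1 - c)) * (a - c)"
  proof -
    consider "a < \<delta>" | "\<delta> \<le> a" "a \<le> 1 - \<delta>" | "a > 1 - \<delta>" by linarith
    then show ?thesis
    proof cases
      case 1
      then have "c = \<delta>" using assms by (auto simp: c_def)
      moreover have "ln \<delta> \<le> ln (1 - \<delta>)" using assms by auto
      ultimately show ?thesis using sa 1 by (auto intro!: mult_nonpos_nonpos)
    next
      case 2
      then have "c = a" using assms by (auto simp: c_def)
      then show ?thesis using sd by simp
    next
      case 3
      then have "c = 1 - \<delta>" using assms by (auto simp: c_def)
      moreover have "ln \<delta> \<le> ln (1 - \<delta>)" using assms by auto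
      ultimately show ?thesis using sa 3 sym by (auto intro!: mult_nonneg_nonneg)
    qed
  qed
  with entropy_tangent[OF assms(5,6) c] show ?thesis
    by (simp add: clamp_logit_def Let_def algebra_simps flip: c_def)
qed

lemma entropy_tendsto_0: "(entropy \<longlongrightarrow> 0) (at_right 0)"
proof -
  have "((\<lambda>a::real. a * ln a) \<longlongrightarrow> 0) (at_right 0)" by real_asymp
  moreover have "((\<lambda>a::real. (1 - a) * ln (1 - a)) \<longlongrightarrow> (1 - 0) * ln (1 - 0)) (at_right 0)"
    by (intro tendsto_intros) auto
  ultimately show ?thesis unfolding entropy_def[abs_def] using tendsto_add by fastforce
qed

text \<open>Supplies the truncation level \<delta> for a prescribed error.\<close>

lemma ex_small_entropy:
  assumes "0 < e"
  obtains \<delta> where "\<bar>entropy \<delta>\<bar> < e" "0 < \<delta>" "\<delta> < 1/2"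
proof -
  have "\<forall>\<^sub>F \<delta> in at_right 0. \<bar>entropy \<delta>\<bar> < e \<and> \<delta> \<in> {0<..<1/2}"
    using tendstoD[OF entropy_tendsto_0 assms]
    by (intro eventually_conj eventually_at_right_real) (auto simp: dist_real_def)
  then show thesis
    using eventually_happens'[OF trivial_limit_at_right_real] that by fastforce
qed

subsection \<open>Integration on the unit interval\<close>


text \<open>The primitive of f from 0, written with an indicator so that all integrals live on the
  one finite measure space \<open>lebesgue_on {0..1}\<close>.\<close>

definition cumint :: "(real \<Rightarrow> real) \<Rightarrow> real \<Rightarrow> real" where
  "cumint f x = (LINT y|lebesgue_on {0..1}. indicator {0..x} y * f y)"

lemma finite_measure_unit: "finite_measure (lebesgue_on {0..1::real})"
  by (intro finite_measureI) (simp add: emeasure_restrict_space)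

lemma measure_unit: "measure (lebesgue_on {0..1::real}) {0..1} = 1"
  by (simp add: measure_restrict_space)

lemma LINT_unit_const: "(LINT x|lebesgue_on {0..1::real}. (c::real)) = c"
  by (simp add: measure_unit)

lemma integrable_unit_bound:
  fixes f :: "real \<Rightarrow> real"
  assumes "f \<in> borel_measurable (lebesgue_on {0..1})" "AE x in lebesgue_on {0..1}. \<bar>f x\<bar> \<le> B"
  shows "integrable (lebesgue_on {0..1}) f"
  using finite_measure.integrable_const_bound[OF finite_measure_unit _ assms(1)] assms(2) by simp

lemma measurable_indicator_unit [measurable]:
  "(indicator {a..b} :: real \<Rightarrow> real) \<in> borel_measurable (lebesgue_on {0..1::real})"
  "(indicator {a<..b} :: real \<Rightarrow> real) \<in> borel_measurable (lebesgue_on {0..1::real})"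
  by (intro measurable_restrict_space1 borel_measurable_indicator; simp)+

lemma integrable_unit_mult:
  fixes f g :: "real \<Rightarrow> real"
  assumes "integrable (lebesgue_on {0..1}) f"
    and "g \<in> borel_measurable (lebesgue_on {0..1})" "AE x in lebesgue_on {0..1}. \<bar>g x\<bar> \<le> B"
  shows "integrable (lebesgue_on {0..1}) (\<lambda>x. g x * f x)"
proof (rule Bochner_Integration.integrable_bound)
  show "integrable (lebesgue_on {0..1}) (\<lambda>x. B * f x)" using assms(1) by simp
  show "(\<lambda>x. g x * f x) \<in> borel_measurable (lebesgue_on {0..1})"
    using assms(1,2) by (auto intro: borel_measurable_times)
  show "AE x in lebesgue_on {0..1}. norm (g x * f x) \<le> norm (B * f x)"
    using assms(3) by eventually_elim (auto simp: abs_mult intro: mult_right_mono)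
qed

lemma integrable_unit_indicator_mult:
  fixes f :: "real \<Rightarrow> real"
  assumes "integrable (lebesgue_on {0..1}) f"
  shows "integrable (lebesgue_on {0..1}) (\<lambda>x. indicator {a..b} x * f x)"
  by (rule integrable_unit_mult[where B=1, OF assms]) (auto split: split_indicator)

lemma cumint_1: "cumint f 1 = (LINT y|lebesgue_on {0..1}. f y)"
  unfolding cumint_def by (rule Bochner_Integration.integral_cong) auto

lemma cumint_cong_AE:
  assumes "AE x in lebesgue_on {0..1}. f x = g x"
    "f \<in> borel_measurable (lebesgue_on {0..1})" "g \<in> borel_measurable (lebesgue_on {0..1})"
  shows "cumint f x = cumint g x"
  unfolding cumint_def using assms
  by (intro integral_cong_AE) (auto elim!: eventually_mono)

lemma cumint_diff:
  assumes "integrable (lebesgue_on {0..1}) f" "integrable (lebesgue_on {0..1}) g"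
  shows "cumint (\<lambda>y. f y - g y) x = cumint f x - cumint g x"
  unfolding cumint_def
  using assms[THEN integrable_unit_indicator_mult, of 0 x]
  by (simp add: right_diff_distrib)

text \<open>Translates the set integrals of \<open>K_exp\<close> and \<open>K_with\<close>.\<close>

lemma set_lebesgue_integral_eq_cumint:
  assumes "x \<in> {0..1}"
  shows "(LINT y:{0..x}|lebesgue. f y) = cumint f x"
proof -
  have "cumint f x = (LINT y|lebesgue. indicator {0..1} y *\<^sub>R (indicator {0..x} y * f y))"
    unfolding cumint_def by (subst integral_restrict_space) auto
  also have "\<dots> = (LINT y:{0..x}|lebesgue. f y)"
    unfolding set_lebesgue_integral_def
    using assms by (intro Bochner_Integration.integral_cong) (auto simp: indicator_def)
  finally show ?thesis ..
qed

text \<open>The difference is an integral over an interval of length |x - y|. It yields the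
  continuity of \<phi> and, with B = 1, the control of a supremum by finitely many grid
  values.\<close>

lemma cumint_lipschitz:
  assumes f: "f \<in> borel_measurable (lebesgue_on {0..1})" and bd: "AE x in lebesgue_on {0..1}. \<bar>f x\<bar> \<le> B"
    and xy: "x \<in> {0..1}" "y \<in> {0..1}"
  shows "\<bar>cumint f x - cumint f y\<bar> \<le> B * \<bar>x - y\<bar>"
proof -
  have *: "\<bar>cumint f y - cumint f x\<bar> \<le> B * (y - x)" if "0 \<le> x" "x \<le> y" "y \<le> 1" for x y
  proof -
    note i = integrable_unit_bound[OF f bd, THEN integrable_unit_indicator_mult]
    have "cumint f y - cumint f x = (LINT z|lebesgue_on {0..1}. indicator {x<..y} z * f z)"
      unfolding cumint_def using that
      by (subst Bochner_Integration.integral_diff[OF i i, symmetric])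
         (auto intro!: Bochner_Integration.integral_cong split: split_indicator)
    also have "\<bar>\<dots>\<bar> \<le> (LINT z|lebesgue_on {0..1}. \<bar>indicator {x<..y} z * f z\<bar>)"
      by (rule integral_abs_bound)
    also have "\<dots> \<le> (LINT z|lebesgue_on {0..1}. B * indicator {x<..y} z)"
    proof (rule integral_mono_AE)
      show "integrable (lebesgue_on {0..1}) (\<lambda>z. \<bar>indicator {x<..y} z * f z\<bar>)"
        by (intro Bochner_Integration.integrable_abs integrable_unit_mult[where B=1] integrable_unit_bound[OF f bd])
           (auto split: split_indicator)
      show "integrable (lebesgue_on {0..1}) (\<lambda>z. B * indicator {x<..y} z)"
        by (intro integrable_mult_right integrable_unit_bound[where B=1])
           (auto split: split_indicator)
      show "AE z in lebesgue_on {0..1}. \<bar>indicator {x<..y} z * f z\<bar> \<le> B * indicator {x<..y} z"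
        using bd by eventually_elim (auto split: split_indicator)
    qed
    also have "\<dots> = B * measure (lebesgue_on {0..1}) ({0..1} \<inter> {x<..y})"
      by (simp add: Int_commute)
    also have "{0..1} \<inter> {x<..y} = {x<..y}" using that by auto
    also have "measure (lebesgue_on {0..1}) {x<..y} = y - x"
      using that by (subst measure_restrict_space) auto
    finally show ?thesis .
  qed
  show ?thesis
    using *[of x y] *[of y x] xy by (cases "x \<le> y") (auto simp: abs_minus_commute)
qed

lemma continuous_on_cumint:
  assumes "f \<in> borel_measurable (lebesgue_on {0..1})" "AE x in lebesgue_on {0..1}. \<bar>f x\<bar> \<le> B"
  shows "continuous_on {0..1} (cumint f)"
proof (rule lipschitz_on_continuous_on[OF lipschitz_onI])
  \<comment> \<open>A Lipschitz constant has to be nonnegative, hence the absolute value of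
    B.\<close>
  show "dist (cumint f x) (cumint f y) \<le> \<bar>B\<bar> * dist x y" if "x \<in> {0..1}" "y \<in> {0..1}" for x y
    using cumint_lipschitz[OF assms that] unfolding dist_real_def
    by (meson abs_ge_self abs_ge_zero mult_right_mono order_trans)
qed simp

lemma measurable_unit_continuous:
  fixes f :: "real \<Rightarrow> real"
  shows "continuous_on {0..1} f \<Longrightarrow> f \<in> borel_measurable (lebesgue_on {0..1})"
  by (rule continuous_imp_measurable_on_sets_lebesgue) auto

lemma abs_cumint_le:
  assumes "integrable (lebesgue_on {0..1}) f"
  shows "\<bar>cumint f x\<bar> \<le> (LINT y|lebesgue_on {0..1}. \<bar>f y\<bar>)"
proof -
  have "\<bar>cumint f x\<bar> \<le> (LINT y|lebesgue_on {0..1}. \<bar>indicator {0..x} y * f y\<bar>)"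
    unfolding cumint_def by (rule integral_abs_bound)
  also have "\<dots> \<le> (LINT y|lebesgue_on {0..1}. \<bar>f y\<bar>)"
    using assms integrable_unit_indicator_mult[OF assms]
    by (intro integral_mono) (auto simp: indicator_def)
  finally show ?thesis .
qed

text \<open>Integration by parts for primitives of L1 functions: f(x) g(y) is integrated over the
  triangle y \<le> x in both orders.\<close>

lemma integral_mult_cumint:
  assumes f: "integrable (lebesgue_on {0..1}) f" and g: "integrable (lebesgue_on {0..1}) g"
  shows "(LINT x|lebesgue_on {0..1}. f x * cumint g x) =
    (LINT x|lebesgue_on {0..1}. f x) * (LINT x|lebesgue_on {0..1}. g x) -
    (LINT x|lebesgue_on {0..1}. g x * cumint f x)"
proof -
  let ?L = "lebesgue_on {0..1::real}"
  interpret finite_measure ?L by (rule finite_measure_unit)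
  interpret pair_sigma_finite ?L ?L ..
  have [measurable]: "f \<in> borel_measurable ?L" "g \<in> borel_measurable ?L" using f g by auto
  have [measurable]: "(\<lambda>x. x) \<in> borel_measurable ?L"
    by (intro measurable_restrict_space1 measurable_completion) auto
  define F where "F = (\<lambda>(x, y). (if y \<le> x then 1 else 0 :: real) * (f x * g y))"
  have prod: "integrable (?L \<Otimes>\<^sub>M ?L) (\<lambda>(x, y). f x * g y)"
  proof (rule Fubini_integrable)
    show "AE x in ?L. integrable ?L (\<lambda>y. case (x, y) of (x, y) \<Rightarrow> f x * g y)" using g by auto
    show "integrable ?L (\<lambda>x. LINT y|?L. norm (case (x, y) of (x, y) \<Rightarrow> f x * g y))"
      using f by (simp add: abs_mult)
  qed simp
  have F: "integrable (?L \<Otimes>\<^sub>M ?L) F"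
    by (rule Bochner_Integration.integrable_bound[OF prod]) (auto simp: F_def split: prod.splits)
  have ge: "(LINT x|?L. f x * (if y \<le> x then 1 else 0)) = (LINT x|?L. f x) - cumint f y"
    for y
  proof -
    \<comment> \<open>The condition y \<le> x and the indicator of \<open>{0..y}\<close> overlap at
      x = y, so they are complementary only up to this null set.\<close>
    have *: "AE x in ?L. x \<noteq> y"
      by (subst AE_restrict_space_iff) (auto intro: AE_I'[of "{y}"])
    have "(LINT x|?L. f x * (if y \<le> x then 1 else 0)) = (LINT x|?L. f x - indicator {0..y} x * f x)"
    proof (rule integral_cong_AE)
      show "AE x in ?L. f x * (if y \<le> x then 1 else 0) = f x - indicator {0..y} x * f x"
        using * AE_space by eventually_elim (auto simp: indicator_def)
    qed auto
    also have "\<dots> = (LINT x|?L. f x) - cumint f y"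
      unfolding cumint_def using f integrable_unit_indicator_mult[OF f, of 0 y] by simp
    finally show ?thesis .
  qed
  have Fy: "(LINT x|?L. F (x, y)) = g y * (LINT x|?L. f x) - g y * cumint f y" for y
  proof -
    have "(LINT x|?L. F (x, y)) = (LINT x|?L. g y * (f x * (if y \<le> x then 1 else 0)))"
      unfolding F_def by (intro Bochner_Integration.integral_cong) auto
    then show ?thesis by (simp only: integral_mult_right_zero ge right_diff_distrib)
  qed
  have "(LINT x|?L. f x * cumint g x) = (LINT x|?L. LINT y|?L. F (x, y))"
  proof (rule Bochner_Integration.integral_cong[OF refl])
    fix x
    have "(LINT y|?L. F (x, y)) = (LINT y|?L. f x * (indicator {0..x} y * g y))"
      unfolding F_def by (intro Bochner_Integration.integral_cong) (auto split: split_indicator)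
    then show "f x * cumint g x = (LINT y|?L. F (x, y))" by (simp add: cumint_def)
  qed
  also have "\<dots> = (LINT y|?L. LINT x|?L. F (x, y))"
    using Fubini_integral[of "\<lambda>x y. F (x, y)"] F by simp
  also have "\<dots> = (LINT y|?L. g y * (LINT x|?L. f x) - g y * cumint f y)" by (simp add: Fy)
  also have "\<dots> = (LINT x|?L. f x) * (LINT x|?L. g x) - (LINT x|?L. g x * cumint f x)"
  proof -
    \<comment> \<open>Integrability of g times the primitive of f is read off from the second Fubini
      marginal, of which it is the nontrivial part.\<close>
    have "integrable ?L (\<lambda>y. g y * (LINT x|?L. f x) - g y * cumint f y)"
      using F integrable_snd[of "\<lambda>x y. F (x, y)"] by (simp add: Fy)
    from Bochner_Integration.integrable_diff[OF integrable_mult_left[OF g, of "LINT x|?L. f x"] this]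
    have "integrable ?L (\<lambda>y. g y * cumint f y)" by simp
    then show ?thesis using g by simp
  qed
  finally show ?thesis .
qed

subsection \<open>Admissible densities\<close>


lemma unit_lborel_simps:
  "sets unit_lborel = sets (restrict_space borel {0..1})" "space unit_lborel = {0..1}"
  by (simp_all add: unit_lborel_def sets_restrict_space)

lemma finite_measure_unit_lborel: "finite_measure unit_lborel"
  by (intro finite_measureI) (simp add: unit_lborel_def emeasure_restrict_space)

text \<open>Radon-Nikodym densities live on the Borel space \<open>unit_lborel\<close>, while the
  functional integrates over \<open>lebesgue_on {0..1}\<close>. This lemma and the next two carry
  measurability, null sets and integrals from the first to the second.\<close>

lemma measurable_unit_lborel_imp_lebesgue:
  fixes f :: "real \<Rightarrow> 'a :: real_normed_vector"
  assumes "f \<in> borel_measurable unit_lborel"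
  shows "f \<in> borel_measurable (lebesgue_on {0..1})"
proof -
  have "(\<lambda>x. indicator {0..1} x *\<^sub>R f x) \<in> borel_measurable lborel"
    using assms unfolding unit_lborel_def by (subst (asm) borel_measurable_restrict_space_iff) auto
  then have "(\<lambda>x. indicator {0..1} x *\<^sub>R f x) \<in> borel_measurable lebesgue"
    by (rule measurable_completion)
  then show ?thesis by (subst borel_measurable_restrict_space_iff) auto
qed

lemma AE_unit_lborel_imp_lebesgue:
  assumes "AE x in unit_lborel. P x"
  shows "AE x in lebesgue_on {0..1}. P x"
proof -
  have "AE x in lborel. x \<in> {0..1} \<longrightarrow> P x"
    using assms unfolding unit_lborel_def by (subst (asm) AE_restrict_space_iff) auto
  then show ?thesis by (subst AE_restrict_space_iff) (auto intro: AE_completion)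
qed

lemma LINT_unit_lborel:
  fixes f :: "real \<Rightarrow> real"
  assumes "f \<in> borel_measurable unit_lborel"
  shows "(LINT x|unit_lborel. f x) = (LINT x|lebesgue_on {0..1}. f x)"
proof -
  have "(\<lambda>x. indicator {0..1} x *\<^sub>R f x) \<in> borel_measurable lborel"
    using assms unfolding unit_lborel_def by (subst (asm) borel_measurable_restrict_space_iff) auto
  then show ?thesis
    unfolding unit_lborel_def by (subst (1 2) integral_restrict_space) (auto simp: integral_completion)
qed

lemma measurable_indicator_unit_lborel [measurable]:
  "(indicator {a..b} :: real \<Rightarrow> real) \<in> borel_measurable unit_lborel"
  unfolding unit_lborel_def by (intro measurable_restrict_space1 borel_measurable_indicator) simp

text \<open>The bound on g makes it integrable, so the nonnegative integral defining the density
  measure is a Bochner integral.\<close>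

lemma emeasure_density_unit_lborel:
  assumes [measurable]: "g \<in> borel_measurable unit_lborel"
    and bd: "AE x in unit_lborel. 0 \<le> g x \<and> g x \<le> B" and x: "x \<in> {0..1}"
  shows "emeasure (density unit_lborel (\<lambda>x. ennreal (g x))) {0..x} = ennreal (cumint g x)"
proof -
  interpret finite_measure unit_lborel by (rule finite_measure_unit_lborel)
  have "{0..x} \<in> sets unit_lborel"
    using x by (auto simp: unit_lborel_simps sets_restrict_space_iff)
  then have "emeasure (density unit_lborel (\<lambda>x. ennreal (g x))) {0..x}
      = (\<integral>\<^sup>+ y. ennreal (g y) * indicator {0..x} y \<partial>unit_lborel)"
    by (intro emeasure_density) auto
  also have "\<dots> = (\<integral>\<^sup>+ y. ennreal (indicator {0..x} y * g y) \<partial>unit_lborel)"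
    by (intro nn_integral_cong) (auto split: split_indicator)
  also have "\<dots> = ennreal (LINT y|unit_lborel. indicator {0..x} y * g y)"
  proof (rule nn_integral_eq_integral)
    show "integrable unit_lborel (\<lambda>y. indicator {0..x} y * g y)"
    proof (rule integrable_const_bound)
      show "AE y in unit_lborel. norm (indicator {0..x} y * g y) \<le> B"
        using bd by eventually_elim (auto split: split_indicator)
    qed simp
    show "AE y in unit_lborel. 0 \<le> indicator {0..x} y * g y"
      using bd by eventually_elim (auto split: split_indicator)
  qed
  also have "(LINT y|unit_lborel. indicator {0..x} y * g y) = cumint g x"
    unfolding cumint_def by (rule LINT_unit_lborel) simp
  finally show ?thesis .
qed

text \<open>Here u stands for \<epsilon> times the derivative of \<phi>, which normalizes the
  density bound to u \<le> 1; the mass condition says that \<phi> ends at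
  \<open>\<phi>\<^sub>1\<close>. Keeping u as a separate argument allows any version of the density
  to be used.\<close>

definition admissible :: "real \<Rightarrow> real \<Rightarrow> real \<Rightarrow> (real \<Rightarrow> real) \<Rightarrow> (real \<Rightarrow> real) \<Rightarrow> bool" where
  "admissible \<phi>\<^sub>0 \<phi>\<^sub>1 \<epsilon> \<phi> u \<longleftrightarrow> \<phi> \<in> F_space \<phi>\<^sub>0 \<phi>\<^sub>1 \<and>
     u \<in> borel_measurable (lebesgue_on {0..1}) \<and>
     (AE x in lebesgue_on {0..1}. 0 \<le> u x \<and> u x \<le> 1) \<and>
     (LINT x|lebesgue_on {0..1}. u x) = \<epsilon> * (\<phi>\<^sub>1 - \<phi>\<^sub>0) \<and>
     (\<forall>x\<in>{0..1}. \<phi> x = \<phi>\<^sub>0 + cumint u x / \<epsilon>)"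

text \<open>The finite value of \<open>G_functional\<close>, with the density as an explicit
  argument.\<close>

definition action :: "(real \<Rightarrow> real) \<Rightarrow> (real \<Rightarrow> real) \<Rightarrow> (real \<Rightarrow> real) \<Rightarrow> real" where
  "action \<rho> \<phi> u = (LINT x|lebesgue_on {0..1}.
     entropy (\<rho> x) + entropy (u x) + (1 - \<rho> x) * \<phi> x - ln (1 + exp (\<phi> x)))"

lemma real_of_s_entropy:
  "real_of_ereal (s_entropy a) = (if 0 \<le> a \<and> a \<le> 1 then entropy a else 0)"
  by (simp add: s_entropy_def entropy_def)

lemma borel_measurable_entropy [measurable]: "entropy \<in> borel_measurable borel"
  unfolding entropy_def[abs_def] by measurable

lemma borel_measurable_s_entropy [measurable]: "(\<lambda>a. real_of_ereal (s_entropy a)) \<in> borel_measurable borel"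
  unfolding real_of_s_entropy by measurable

lemma AE_abs_le_1:
  fixes u :: "'a \<Rightarrow> real"
  shows "AE x in M. 0 \<le> u x \<and> u x \<le> 1 \<Longrightarrow> AE x in M. \<bar>u x\<bar> \<le> 1"
  by (erule eventually_mono) auto

lemma M_spaceD:
  assumes "\<rho> \<in> M_space"
  shows "\<rho> \<in> borel_measurable (lebesgue_on {0..1})" "AE x in lebesgue_on {0..1}. 0 \<le> \<rho> x \<and> \<rho> x \<le> 1"
  using assms by (auto simp: M_space_def Linf_space_def)

lemma admissible_continuous:
  assumes "admissible \<phi>\<^sub>0 \<phi>\<^sub>1 \<epsilon> \<phi> u"
  shows "continuous_on {0..1} \<phi>"
proof -
  have "continuous_on {0..1} (cumint u)"
    using assms AE_abs_le_1 unfolding admissible_def by (intro continuous_on_cumint[where B=1]) blast+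
  then have "continuous_on {0..1} (\<lambda>x. \<phi>\<^sub>0 + cumint u x / \<epsilon>)"
    unfolding divide_inverse by (intro continuous_intros)
  moreover have "\<forall>x\<in>{0..1}. \<phi> x = \<phi>\<^sub>0 + cumint u x / \<epsilon>" using assms by (simp add: admissible_def)
  ultimately show ?thesis using continuous_on_cong[OF refl, of "{0..1}" \<phi>] by metis
qed

text \<open>The Radon-Nikodym density, integrated over [0,x], returns the increments of \<phi>. Both
  entropy arguments lie in [0,1] almost everywhere, where \<open>s_entropy\<close> and
  \<open>entropy\<close> agree.\<close>

lemma G_functional_eq_action:
  assumes "0 < \<epsilon>" and "\<phi> \<in> F_space \<phi>\<^sub>0 \<phi>\<^sub>1"
    and ac: "absolutely_continuous unit_lborel (d_measure \<phi>\<^sub>0 \<phi>\<^sub>1 \<phi>)"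
    and bd: "AE x in unit_lborel. d_density \<phi>\<^sub>0 \<phi>\<^sub>1 \<phi> x \<le> ennreal (1 / \<epsilon>)"
    and less: "\<phi>\<^sub>0 < \<phi>\<^sub>1"
  defines "u \<equiv> (\<lambda>x. \<epsilon> * enn2real (d_density \<phi>\<^sub>0 \<phi>\<^sub>1 \<phi> x))"
  shows "admissible \<phi>\<^sub>0 \<phi>\<^sub>1 \<epsilon> \<phi> u" "\<rho> \<in> M_space \<Longrightarrow> G_functional \<phi>\<^sub>0 \<phi>\<^sub>1 \<epsilon> \<rho> \<phi> = ereal (action \<rho> \<phi> u)"
proof -
  let ?L = "lebesgue_on {0..1::real}"
  interpret U: finite_measure unit_lborel by (rule finite_measure_unit_lborel)
  obtain \<mu> where rep: "represents \<phi>\<^sub>0 \<phi>\<^sub>1 \<mu> \<phi>" using assms(2) by (auto simp: F_space_def)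
  note \<mu> = d_measure_eq[OF rep]
  define D where "D = d_density \<phi>\<^sub>0 \<phi>\<^sub>1 \<phi>"
  have D [measurable]: "D \<in> borel_measurable unit_lborel" unfolding D_def d_density_def by simp
  have "density unit_lborel D = \<mu>"
    unfolding D_def d_density_def \<mu>
    using ac rep by (intro U.density_RN_deriv) (auto simp: \<mu> represents_def unit_lborel_simps)
  \<comment> \<open>D takes extended values; the bound by 1/\<epsilon> makes it finite almost
    everywhere, so the detour through the reals does not change the measure.\<close>
  moreover have "density unit_lborel D = density unit_lborel (\<lambda>x. ennreal (enn2real (D x)))"
    using bd unfolding D_def[symmetric]
    by (intro density_cong) (auto elim!: eventually_mono simp: ennreal_enn2real le_less_trans[OF _ ennreal_less_top])
  ultimately have dens: "\<mu> = density unit_lborel (\<lambda>x. ennreal (enn2real (D x)))" by simp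
  have gbd: "AE x in unit_lborel. 0 \<le> enn2real (D x) \<and> enn2real (D x) \<le> 1 / \<epsilon>"
    using bd unfolding D_def[symmetric]
    by eventually_elim (use \<open>0 < \<epsilon>\<close> in \<open>auto intro!: enn2real_leI\<close>)
  have em: "emeasure \<mu> {0..x} = ennreal (cumint (\<lambda>x. enn2real (D x)) x)" if "x \<in> {0..1}" for x
    unfolding dens by (rule emeasure_density_unit_lborel[OF _ gbd that]) simp
  have nn: "0 \<le> cumint (\<lambda>x. enn2real (D x)) x" for x
    unfolding cumint_def by (rule Bochner_Integration.integral_nonneg) (auto split: split_indicator)
  have cu: "cumint u x = \<epsilon> * cumint (\<lambda>x. enn2real (D x)) x" for x
    unfolding cumint_def u_def D_def by (simp add: mult.left_commute)
  have meas: "u \<in> borel_measurable ?L"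
    unfolding u_def D_def[symmetric] by (intro measurable_unit_lborel_imp_lebesgue) simp
  have u01: "AE x in ?L. 0 \<le> u x \<and> u x \<le> 1"
    using AE_unit_lborel_imp_lebesgue[OF gbd] unfolding u_def D_def[symmetric]
    by eventually_elim (use \<open>0 < \<epsilon>\<close> in \<open>auto simp: field_simps\<close>)
  show adm: "admissible \<phi>\<^sub>0 \<phi>\<^sub>1 \<epsilon> \<phi> u"
    unfolding admissible_def
  proof (intro conjI ballI assms meas u01)
    have "ennreal (\<phi>\<^sub>1 - \<phi>\<^sub>0) = ennreal (cumint (\<lambda>x. enn2real (D x)) 1)"
      using em[of 1] rep by (simp add: represents_def)
    then have "\<phi>\<^sub>1 - \<phi>\<^sub>0 = cumint (\<lambda>x. enn2real (D x)) 1" using less nn by simp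
    then show "(LINT x|?L. u x) = \<epsilon> * (\<phi>\<^sub>1 - \<phi>\<^sub>0)" unfolding cumint_1[symmetric] cu by simp
    show "\<phi> x = \<phi>\<^sub>0 + cumint u x / \<epsilon>" if "x \<in> {0..1}" for x
      using rep em[OF that] that nn \<open>0 < \<epsilon>\<close> by (simp add: represents_def measure_def cu)
  qed
  have [measurable]: "u \<in> borel_measurable ?L" "\<phi> \<in> borel_measurable ?L"
    using meas measurable_unit_continuous[OF admissible_continuous[OF adm]] by auto
  assume "\<rho> \<in> M_space"
  note \<rho> = M_spaceD[OF this]
  note [measurable] = \<rho>(1)
  have "(LINT x|?L. real_of_ereal (s_entropy (\<rho> x)) + real_of_ereal (s_entropy (u x)) +
      (1 - \<rho> x) * \<phi> x - ln (1 + exp (\<phi> x))) = action \<rho> \<phi> u"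
    unfolding action_def
  proof (rule integral_cong_AE)
    show "AE x in ?L. real_of_ereal (s_entropy (\<rho> x)) + real_of_ereal (s_entropy (u x)) +
        (1 - \<rho> x) * \<phi> x - ln (1 + exp (\<phi> x)) =
        entropy (\<rho> x) + entropy (u x) + (1 - \<rho> x) * \<phi> x - ln (1 + exp (\<phi> x))"
      using u01 \<rho>(2) by eventually_elim (simp add: real_of_s_entropy)
  qed measurable
  then show "G_functional \<phi>\<^sub>0 \<phi>\<^sub>1 \<epsilon> \<rho> \<phi> = ereal (action \<rho> \<phi> u)"
    unfolding G_functional_def u_def using ac bd by simp
qed

lemma action_cong_AE:
  assumes "AE x in lebesgue_on {0..1}. u x = v x" "\<rho> \<in> M_space" "continuous_on {0..1} \<phi>"
    "u \<in> borel_measurable (lebesgue_on {0..1})" "v \<in> borel_measurable (lebesgue_on {0..1})"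
  shows "action \<rho> \<phi> u = action \<rho> \<phi> v"
proof -
  note [measurable] = assms(4,5) M_spaceD(1)[OF assms(2)] measurable_unit_continuous[OF assms(3)]
  show ?thesis unfolding action_def
    by (rule integral_cong_AE) (use assms(1) in \<open>auto elim!: eventually_mono\<close>)
qed

text \<open>Converse direction, producing competitors: it is applied to a constant density and to
  the density of K\<phi>. Continuity makes u Borel, so that a measure with this density exists on
  \<open>unit_lborel\<close>.\<close>

lemma admissible_of_continuous_density:
  assumes "0 < \<epsilon>" and less: "\<phi>\<^sub>0 < \<phi>\<^sub>1" and cont: "continuous_on {0..1} u"
    and bd: "\<And>x. x \<in> {0..1} \<Longrightarrow> 0 \<le> u x \<and> u x \<le> 1"
    and mass: "(LINT x|lebesgue_on {0..1}. u x) = \<epsilon> * (\<phi>\<^sub>1 - \<phi>\<^sub>0)"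
  defines "\<phi> \<equiv> (\<lambda>x\<in>{0..1}. \<phi>\<^sub>0 + cumint u x / \<epsilon>)"
  shows "admissible \<phi>\<^sub>0 \<phi>\<^sub>1 \<epsilon> \<phi> u" "\<rho> \<in> M_space \<Longrightarrow> G_functional \<phi>\<^sub>0 \<phi>\<^sub>1 \<epsilon> \<rho> \<phi> = ereal (action \<rho> \<phi> u)"
proof -
  let ?L = "lebesgue_on {0..1::real}"
  interpret U: finite_measure unit_lborel by (rule finite_measure_unit_lborel)
  define \<mu> where "\<mu> = density unit_lborel (\<lambda>x. ennreal (u x / \<epsilon>))"
  have [measurable]: "u \<in> borel_measurable unit_lborel"
    using borel_measurable_continuous_on_restrict[OF cont]
    by (simp add: measurable_cong_sets[OF unit_lborel_simps(1) refl])
  have meas: "u \<in> borel_measurable ?L" by (rule measurable_unit_continuous[OF cont])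
  have "AE x in unit_lborel. 0 \<le> u x / \<epsilon> \<and> u x / \<epsilon> \<le> 1 / \<epsilon>"
    using bd \<open>0 < \<epsilon>\<close> by (intro AE_I2) (auto simp: unit_lborel_simps divide_right_mono)
  then have em: "emeasure \<mu> {0..x} = ennreal (cumint u x / \<epsilon>)" if "x \<in> {0..1}" for x
    unfolding \<mu>_def using emeasure_density_unit_lborel[of "\<lambda>x. u x / \<epsilon>" "1 / \<epsilon>" x] that
    by (simp add: cumint_def)
  have nn: "0 \<le> cumint u x" for x
    unfolding cumint_def using bd by (intro Bochner_Integration.integral_nonneg) (auto split: split_indicator)
  have rep: "represents \<phi>\<^sub>0 \<phi>\<^sub>1 \<mu> \<phi>"
    unfolding represents_def
  proof (intro conjI ballI)
    show "sets \<mu> = sets (restrict_space borel {0..1})" by (simp add: \<mu>_def unit_lborel_simps)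
    show "emeasure \<mu> {0..1} = ennreal (\<phi>\<^sub>1 - \<phi>\<^sub>0)"
      using em[of 1] mass \<open>0 < \<epsilon>\<close> by (simp add: cumint_1)
    show "\<phi> x = \<phi>\<^sub>0 + measure \<mu> {0..x}" if "x \<in> {0..1}" for x
      using that em[OF that] nn \<open>0 < \<epsilon>\<close> by (simp add: \<phi>_def measure_def)
  qed
  have F: "\<phi> \<in> F_space \<phi>\<^sub>0 \<phi>\<^sub>1" using rep by (auto simp: F_space_def \<phi>_def)
  have ac: "absolutely_continuous unit_lborel (d_measure \<phi>\<^sub>0 \<phi>\<^sub>1 \<phi>)"
    unfolding d_measure_eq[OF rep] \<mu>_def by (rule absolutely_continuousI_density) simp
  \<comment> \<open>\<open>RN_deriv\<close> is only some version of the density; uniqueness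
    identifies it with u/\<epsilon> almost everywhere.\<close>
  have RN: "AE x in unit_lborel. ennreal (u x / \<epsilon>) = d_density \<phi>\<^sub>0 \<phi>\<^sub>1 \<phi> x"
    unfolding d_measure_eq[OF rep] d_density_def by (rule U.RN_deriv_unique) (simp_all add: \<mu>_def)
  have Dbd: "AE x in unit_lborel. d_density \<phi>\<^sub>0 \<phi>\<^sub>1 \<phi> x \<le> ennreal (1 / \<epsilon>)"
    using RN AE_space
  proof eventually_elim
    case (elim x)
    then have "u x / \<epsilon> \<le> 1 / \<epsilon>" using bd \<open>0 < \<epsilon>\<close> by (auto simp: unit_lborel_simps divide_right_mono)
    then show ?case using elim(1) ennreal_leI by metis
  qed
  show adm: "admissible \<phi>\<^sub>0 \<phi>\<^sub>1 \<epsilon> \<phi> u"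
    unfolding admissible_def using F meas mass bd
    by (auto simp: \<phi>_def intro!: AE_I2)
  note G = G_functional_eq_action[OF \<open>0 < \<epsilon>\<close> F ac Dbd less]
  assume \<rho>: "\<rho> \<in> M_space"
  have "AE x in ?L. \<epsilon> * enn2real (d_density \<phi>\<^sub>0 \<phi>\<^sub>1 \<phi> x) = u x"
    using AE_unit_lborel_imp_lebesgue[OF RN] AE_space
  proof eventually_elim
    case (elim x)
    have "enn2real (ennreal (u x / \<epsilon>)) = u x / \<epsilon>" using bd[of x] elim(2) \<open>0 < \<epsilon>\<close> by simp
    then show ?case using elim(1) \<open>0 < \<epsilon>\<close> by simp
  qed
  from action_cong_AE[OF this \<rho> admissible_continuous[OF adm] _ meas] G(1) G(2)[OF \<rho>]
  show "G_functional \<phi>\<^sub>0 \<phi>\<^sub>1 \<epsilon> \<rho> \<phi> = ereal (action \<rho> \<phi> u)"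
    by (simp add: admissible_def)
qed


section \<open>Integrability of the action, and the logistic function\<close>

lemma integrable_unit_continuous:
  fixes f :: "real \<Rightarrow> real"
  assumes "continuous_on {0..1} f"
  shows "integrable (lebesgue_on {0..1}) f"
proof -
  have "bounded (f ` {0..1})" by (intro compact_imp_bounded compact_continuous_image assms) simp
  then obtain B where "\<And>x. x \<in> {0..1} \<Longrightarrow> \<bar>f x\<bar> \<le> B"
    unfolding bounded_iff by (metis image_eqI real_norm_def)
  then show ?thesis
    by (intro integrable_unit_bound[where B=B] measurable_unit_continuous assms AE_I2) simp
qed

lemma integrable_entropy:
  fixes u :: "real \<Rightarrow> real"
  assumes "u \<in> borel_measurable (lebesgue_on {0..1})" "AE x in lebesgue_on {0..1}. 0 \<le> u x \<and> u x \<le> 1"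
  shows "integrable (lebesgue_on {0..1}) (\<lambda>x. entropy (u x))"
proof (rule integrable_unit_bound)
  show "(\<lambda>x. entropy (u x)) \<in> borel_measurable (lebesgue_on {0..1})" using assms(1) by measurable
  show "AE x in lebesgue_on {0..1}. \<bar>entropy (u x)\<bar> \<le> ln 2"
    using assms(2) by eventually_elim (simp add: abs_entropy_le)
qed

lemma integrable_action_terms:
  assumes "\<rho> \<in> M_space" and "admissible \<phi>\<^sub>0 \<phi>\<^sub>1 \<epsilon> \<phi> u"
  shows "integrable (lebesgue_on {0..1}) (\<lambda>x. entropy (\<rho> x))"
    "integrable (lebesgue_on {0..1}) (\<lambda>x. entropy (u x))"
    "integrable (lebesgue_on {0..1}) (\<lambda>x. (1 - \<rho> x) * \<phi> x)"
    "integrable (lebesgue_on {0..1}) (\<lambda>x. ln (1 + exp (\<phi> x)))"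
proof -
  note \<rho> = M_spaceD[OF assms(1)] and cont = admissible_continuous[OF assms(2)]
  show "integrable (lebesgue_on {0..1}) (\<lambda>x. entropy (\<rho> x))" by (rule integrable_entropy[OF \<rho>])
  show "integrable (lebesgue_on {0..1}) (\<lambda>x. entropy (u x))"
    using assms(2) unfolding admissible_def by (intro integrable_entropy) auto
  show "integrable (lebesgue_on {0..1}) (\<lambda>x. (1 - \<rho> x) * \<phi> x)"
  proof (intro integrable_unit_mult[where B=1] integrable_unit_continuous cont)
    show "AE x in lebesgue_on {0..1}. \<bar>1 - \<rho> x\<bar> \<le> 1" using \<rho>(2) by eventually_elim auto
  qed (use \<rho>(1) in simp)
  show "integrable (lebesgue_on {0..1}) (\<lambda>x. ln (1 + exp (\<phi> x)))"
    by (intro integrable_unit_continuous continuous_intros cont) (auto simp: add_pos_pos less_imp_neq[symmetric])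
qed

text \<open>Let t be the slope at a. Convexity of exp with weights 1 - t and t at the points 0 and b
  - a gives exp(t (b - a)) \<le> (1 + e^b)/(1 + e^a); take logarithms.\<close>

lemma softplus_tangent:
  fixes a b :: real
  shows "ln (1 + exp a) + exp a / (1 + exp a) * (b - a) \<le> ln (1 + exp b)"
proof -
  define t where "t = exp a / (1 + exp a)"
  have p: "0 < 1 + exp c" for c :: real by (simp add: add_pos_pos)
  have t: "0 \<le> t" "t \<le> 1" using p[of a] by (auto simp: t_def field_simps)
  have "exp ((1 - t) *\<^sub>R 0 + t *\<^sub>R (b - a)) \<le> (1 - t) * exp 0 + t * exp (b - a)"
    using t by (intro convex_onD[OF exp_convex]) auto
  then have "exp (t * (b - a)) \<le> 1 - t + t * exp (b - a)" by simp
  also have "1 - t = 1 / (1 + exp a)" using p[of a] by (simp add: t_def field_simps)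
  also have "t * exp (b - a) = exp b / (1 + exp a)"
    unfolding t_def by (simp add: exp_diff)
  also have "1 / (1 + exp a) + exp b / (1 + exp a) = (1 + exp b) / (1 + exp a)"
    by (simp add: add_divide_distrib)
  finally have "t * (b - a) \<le> ln ((1 + exp b) / (1 + exp a))"
    using p by (subst ln_ge_iff) auto
  also have "\<dots> = ln (1 + exp b) - ln (1 + exp a)"
    using p[of a] p[of b] by (intro ln_divide_pos) auto
  finally show ?thesis by (simp add: t_def)
qed

text \<open>The mass is Lipschitz and strictly increasing in A, so the intermediate value theorem
  gives existence and monotonicity gives uniqueness. This justifies the \<open>THE\<close> in
  \<open>K_const\<close>.\<close>

lemma ex1_logistic_mass:
  fixes E :: "real \<Rightarrow> real" and m :: real
  assumes cont: "continuous_on {0..1} E" and pos: "\<And>x. x \<in> {0..1} \<Longrightarrow> 0 < E x" and m: "0 < m" "m < 1"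
  shows "\<exists>!A. 0 < A \<and> (LINT x|lebesgue_on {0..1}. A * E x / (1 + A * E x)) = m"
proof -
  let ?L = "lebesgue_on {0..1::real}"
  define F where "F A = (LINT x|?L. A * E x / (1 + A * E x))" for A
  obtain x1 where x1: "x1 \<in> {0..1}" "\<And>x. x \<in> {0..1} \<Longrightarrow> E x1 \<le> E x"
    using continuous_attains_inf[OF _ _ cont] by auto
  obtain x2 where x2: "x2 \<in> {0..1}" "\<And>x. x \<in> {0..1} \<Longrightarrow> E x \<le> E x2"
    using continuous_attains_sup[OF _ _ cont] by auto
  have ne: "1 + A * E x \<noteq> 0" if "0 \<le> A" "x \<in> {0..1}" for A x
    using that pos[of x] by (smt (verit) mult_nonneg_nonneg)
  have int: "integrable ?L (\<lambda>x. A * E x / (1 + A * E x))" if "0 \<le> A" for A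
    using ne that by (intro integrable_unit_continuous continuous_intros cont) auto
  have mono: "a / (1 + a) \<le> b / (1 + b)" if "0 \<le> a" "a \<le> b" for a b :: real
    using that by (simp add: field_simps)
  have smono: "a / (1 + a) < b / (1 + b)" if "0 \<le> a" "a < b" for a b :: real
    using that by (simp add: field_simps)
  have val: "(m / ((1 - m) * E x)) * E x / (1 + (m / ((1 - m) * E x)) * E x) = m" if "x \<in> {0..1}" for x
    using m pos[OF that] by (simp add: field_simps)
  \<comment> \<open>By \<open>val\<close>, A1 makes the integrand equal to m where E is largest,
    hence at most m everywhere; A2 does the same where E is smallest, with the opposite
    inequality.\<close>
  define A1 where "A1 = m / ((1 - m) * E x2)"
  define A2 where "A2 = m / ((1 - m) * E x1)"
  have A: "0 < A1" "0 < A2" using m pos x1(1) x2(1) by (auto simp: A1_def A2_def)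
  have le: "A1 \<le> A2" unfolding A1_def A2_def
    using m pos[OF x1(1)] x2(2)[OF x1(1)] by (intro divide_left_mono mult_left_mono mult_pos_pos) auto
  have F1: "F A1 \<le> m"
  proof -
    have "F A1 \<le> (LINT x|?L. m)" unfolding F_def
    proof (rule integral_mono[OF int])
      show "A1 * E x / (1 + A1 * E x) \<le> m" if "x \<in> space ?L" for x
        using that mono[of "A1 * E x" "A1 * E x2"] A pos[of x] x2(2)[of x] val[OF x2(1), folded A1_def]
        by auto
    qed (use A in \<open>auto intro!: integrable_unit_continuous\<close>)
    then show ?thesis by (simp only: LINT_unit_const)
  qed
  have F2: "m \<le> F A2"
  proof -
    have "(LINT x|?L. m) \<le> F A2" unfolding F_def
    proof (rule integral_mono[OF _ int])
      show "m \<le> A2 * E x / (1 + A2 * E x)" if "x \<in> space ?L" for x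
        using that mono[of "A2 * E x1" "A2 * E x"] A pos[OF x1(1)] x1(2)[of x] val[OF x1(1), folded A2_def]
        by auto
    qed (use A in \<open>auto intro!: integrable_unit_continuous\<close>)
    then show ?thesis by (simp only: LINT_unit_const)
  qed
  \<comment> \<open>Over a common denominator the numerator is (a - b) E, and both factors of the
    denominator are at least 1.\<close>
  have lip: "\<bar>F a - F b\<bar> \<le> E x2 * \<bar>a - b\<bar>" if "0 \<le> a" "0 \<le> b" for a b
  proof -
    have "\<bar>F a - F b\<bar> = \<bar>LINT x|?L. a * E x / (1 + a * E x) - b * E x / (1 + b * E x)\<bar>"
      unfolding F_def using int that by simp
    also have "\<dots> \<le> (LINT x|?L. \<bar>a * E x / (1 + a * E x) - b * E x / (1 + b * E x)\<bar>)"
      by (rule integral_abs_bound)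
    also have "\<dots> \<le> (LINT x|?L. E x2 * \<bar>a - b\<bar>)"
    proof (rule integral_mono)
      fix x assume "x \<in> space ?L"
      then have x: "x \<in> {0..1}" by simp
      have E: "0 < E x" "E x \<le> E x2" using pos x2 x by auto
      have ge: "1 \<le> 1 + a * E x" "1 \<le> 1 + b * E x" using E that by auto
      then have P: "1 \<le> (1 + a * E x) * (1 + b * E x)" by (metis mult_mono' mult_1 zero_le_one)
      have "a * E x / (1 + a * E x) - b * E x / (1 + b * E x) = (a - b) * E x / ((1 + a * E x) * (1 + b * E x))"
        using ge by (simp add: diff_frac_eq algebra_simps)
      also have "\<bar>\<dots>\<bar> = \<bar>(a - b) * E x\<bar> / ((1 + a * E x) * (1 + b * E x))" using P by simp
      also have "\<dots> \<le> \<bar>(a - b) * E x\<bar>" using P by (simp add: divide_le_eq mult_le_cancel_left1)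
      also have "\<dots> \<le> E x2 * \<bar>a - b\<bar>" using E by (simp add: abs_mult mult.commute mult_right_mono)
      finally show "\<bar>a * E x / (1 + a * E x) - b * E x / (1 + b * E x)\<bar> \<le> E x2 * \<bar>a - b\<bar>" .
    qed (use int that in \<open>auto intro!: integrable_unit_continuous[of "\<lambda>x. E x2 * \<bar>a - b\<bar>"]\<close>)
    finally show ?thesis by (simp only: LINT_unit_const)
  qed
  have "continuous_on {A1..A2} F"
  proof (rule lipschitz_on_continuous_on[OF lipschitz_onI])
    show "dist (F a) (F b) \<le> E x2 * dist a b" if "a \<in> {A1..A2}" "b \<in> {A1..A2}" for a b
      using lip[of a b] that A by (auto simp: dist_real_def)
    show "0 \<le> E x2" using pos[OF x2(1)] by simp
  qed
  then obtain A0 where A0: "A1 \<le> A0" "A0 \<le> A2" "F A0 = m"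
    using IVT'[OF F1 F2 le] by auto
  have strict: "F a < F b" if "0 < a" "a < b" for a b
    unfolding F_def
  proof (rule finite_measure.integral_less_AE_space[OF finite_measure_unit])
    show "AE x in ?L. a * E x / (1 + a * E x) < b * E x / (1 + b * E x)"
      using that pos by (intro AE_I2 smono) (auto simp: less_imp_le)
  qed (use int that in \<open>auto simp: emeasure_restrict_space\<close>)
  show ?thesis
    unfolding F_def[symmetric]
  proof (rule ex1I[of _ A0])
    show "0 < A0 \<and> F A0 = m" using A0 A by simp
    show "B = A0" if "0 < B \<and> F B = m" for B
      using strict[of B A0] strict[of A0 B] that A0 A by (cases B A0 rule: linorder_cases) auto
  qed
qed

subsection \<open>Minimizers are fixed points\<close>


text \<open>Finiteness depends on \<phi> alone. Hence finiteness at one \<sigma> yields a single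
  density u that represents the values at every \<rho>, which is what comparing two densities
  requires.\<close>

lemma G_finite_admissible:
  assumes "\<phi>\<^sub>0 < \<phi>\<^sub>1" "0 < \<epsilon>" "\<phi> \<in> F_space \<phi>\<^sub>0 \<phi>\<^sub>1"
    and fin: "G_functional \<phi>\<^sub>0 \<phi>\<^sub>1 \<epsilon> \<sigma> \<phi> \<noteq> \<infinity>"
  obtains u where "admissible \<phi>\<^sub>0 \<phi>\<^sub>1 \<epsilon> \<phi> u"
    "\<And>\<rho>. \<rho> \<in> M_space \<Longrightarrow> G_functional \<phi>\<^sub>0 \<phi>\<^sub>1 \<epsilon> \<rho> \<phi> = ereal (action \<rho> \<phi> u)"
proof -
  have *: "absolutely_continuous unit_lborel (d_measure \<phi>\<^sub>0 \<phi>\<^sub>1 \<phi>)"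
    "AE x in unit_lborel. d_density \<phi>\<^sub>0 \<phi>\<^sub>1 \<phi> x \<le> ennreal (1 / \<epsilon>)"
    using fin unfolding G_functional_def by (meson)+
  show ?thesis
    by (rule that[OF G_functional_eq_action[OF assms(2,3) * assms(1)]])
qed

text \<open>The linear profile: its constant density \<epsilon>
  (\<open>\<phi>\<^sub>1 - \<phi>\<^sub>0\<close>) lies in (0,1) precisely because \<epsilon> is
  below the threshold.\<close>

lemma ex_admissible:
  assumes "\<phi>\<^sub>0 < \<phi>\<^sub>1" "0 < \<epsilon>" "\<epsilon> < 1 / (\<phi>\<^sub>1 - \<phi>\<^sub>0)"
  obtains \<phi> u where "admissible \<phi>\<^sub>0 \<phi>\<^sub>1 \<epsilon> \<phi> u"
    "\<And>\<rho>. \<rho> \<in> M_space \<Longrightarrow> G_functional \<phi>\<^sub>0 \<phi>\<^sub>1 \<epsilon> \<rho> \<phi> = ereal (action \<rho> \<phi> u)"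
proof -
  have m: "0 < \<epsilon> * (\<phi>\<^sub>1 - \<phi>\<^sub>0)" "\<epsilon> * (\<phi>\<^sub>1 - \<phi>\<^sub>0) < 1" using assms by (auto simp: field_simps)
  note * = admissible_of_continuous_density[OF assms(2,1), of "\<lambda>_. \<epsilon> * (\<phi>\<^sub>1 - \<phi>\<^sub>0)"]
  show ?thesis
    by (rule that[OF *]) (use m in \<open>auto simp: measure_unit\<close>)
qed

lemma minimizer_is_fixed_point:
  assumes less: "\<phi>\<^sub>0 < \<phi>\<^sub>1" and eps: "0 < \<epsilon>" "\<epsilon> < 1 / (\<phi>\<^sub>1 - \<phi>\<^sub>0)" and \<rho>: "\<rho> \<in> M_space"
    and min: "\<phi> \<in> minimizers \<phi>\<^sub>0 \<phi>\<^sub>1 \<epsilon> \<rho>"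
  shows "\<phi> \<in> fixed_points \<phi>\<^sub>0 \<phi>\<^sub>1 \<epsilon> \<rho>"
proof -
  let ?L = "lebesgue_on {0..1::real}"
  have F: "\<phi> \<in> F_space \<phi>\<^sub>0 \<phi>\<^sub>1" using min by (simp add: minimizers_def)
  have le: "G_functional \<phi>\<^sub>0 \<phi>\<^sub>1 \<epsilon> \<rho> \<phi> \<le> G_functional \<phi>\<^sub>0 \<phi>\<^sub>1 \<epsilon> \<rho> \<psi>" if "admissible \<phi>\<^sub>0 \<phi>\<^sub>1 \<epsilon> \<psi> v" for \<psi> v
    using min that by (simp add: minimizers_def admissible_def)
  \<comment> \<open>The linear profile is a competitor of finite value.\<close>
  have "G_functional \<phi>\<^sub>0 \<phi>\<^sub>1 \<epsilon> \<rho> \<phi> \<noteq> \<infinity>"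
    by (rule ex_admissible[OF less eps]) (use le \<rho> in fastforce)
  then obtain u where adm: "admissible \<phi>\<^sub>0 \<phi>\<^sub>1 \<epsilon> \<phi> u" and G: "G_functional \<phi>\<^sub>0 \<phi>\<^sub>1 \<epsilon> \<rho> \<phi> = ereal (action \<rho> \<phi> u)"
    using G_finite_admissible[OF less eps(1) F] \<rho> by metis
  have u: "u \<in> borel_measurable ?L" "AE x in ?L. 0 \<le> u x \<and> u x \<le> 1" "(LINT x|?L. u x) = \<epsilon> * (\<phi>\<^sub>1 - \<phi>\<^sub>0)"
    and \<phi>: "\<And>x. x \<in> {0..1} \<Longrightarrow> \<phi> x = \<phi>\<^sub>0 + cumint u x / \<epsilon>"
    using adm by (auto simp: admissible_def)
  note cont = admissible_continuous[OF adm]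
  note \<rho>' = M_spaceD[OF \<rho>]
  \<comment> \<open>h is the derivative of (1 - \<rho>) \<phi> - log(1 + e^\<phi>) with respect to
    \<phi>.\<close>
  define h where "h x = 1 / (1 + exp (\<phi> x)) - \<rho> x" for x
  have h: "h \<in> borel_measurable ?L" "AE x in ?L. \<bar>h x\<bar> \<le> 1"
  proof -
    note [measurable] = \<rho>'(1) measurable_unit_continuous[OF cont]
    show "h \<in> borel_measurable ?L" unfolding h_def by measurable
    have "0 < 1 / (1 + exp (\<phi> x)) \<and> 1 / (1 + exp (\<phi> x)) < 1" for x by (simp add: add_pos_pos)
    then show "AE x in ?L. \<bar>h x\<bar> \<le> 1"
      using \<rho>'(2) unfolding h_def
      by (elim eventually_mono) (smt (verit))
  qed
  note h_int = integrable_unit_bound[OF h]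
  have K: "K_exp \<epsilon> \<rho> \<phi> y = exp (cumint h y / \<epsilon>)" if "y \<in> {0..1}" for y
    unfolding K_exp_def h_def[symmetric] set_lebesgue_integral_eq_cumint[OF that] by simp
  note W_cont = continuous_on_cumint[OF h]
  have K_cont: "continuous_on {0..1} (K_exp \<epsilon> \<rho> \<phi>)"
    by (subst continuous_on_cong[OF refl K])
       (use eps(1) in \<open>auto intro!: continuous_intros W_cont\<close>)
  have K_pos: "0 < K_exp \<epsilon> \<rho> \<phi> y" for y by (simp add: K_exp_def)
  have m: "0 < \<epsilon> * (\<phi>\<^sub>1 - \<phi>\<^sub>0)" "\<epsilon> * (\<phi>\<^sub>1 - \<phi>\<^sub>0) < 1" using less eps by (auto simp: field_simps)
  define w where "w A y = A * K_exp \<epsilon> \<rho> \<phi> y / (1 + A * K_exp \<epsilon> \<rho> \<phi> y)" for A y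
  have Kw: "K_with \<phi>\<^sub>0 \<epsilon> \<rho> \<phi> A x = \<phi>\<^sub>0 + cumint (w A) x / \<epsilon>" if "x \<in> {0..1}" for A x
    unfolding K_with_def w_def[symmetric] set_lebesgue_integral_eq_cumint[OF that] by simp
  have Kw1: "K_with \<phi>\<^sub>0 \<epsilon> \<rho> \<phi> A 1 = \<phi>\<^sub>1 \<longleftrightarrow> (LINT x|?L. w A x) = \<epsilon> * (\<phi>\<^sub>1 - \<phi>\<^sub>0)" for A
    using eps(1) by (auto simp: Kw cumint_1 field_simps)
  have "\<exists>!A. 0 < A \<and> (LINT x|?L. w A x) = \<epsilon> * (\<phi>\<^sub>1 - \<phi>\<^sub>0)"
    unfolding w_def by (rule ex1_logistic_mass[OF K_cont K_pos m])
  then have ex1: "\<exists>!A. 0 < A \<and> K_with \<phi>\<^sub>0 \<epsilon> \<rho> \<phi> A 1 = \<phi>\<^sub>1" by (simp only: Kw1)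
  define A where "A = K_const \<phi>\<^sub>0 \<phi>\<^sub>1 \<epsilon> \<rho> \<phi>"
  have A: "0 < A" "(LINT x|?L. w A x) = \<epsilon> * (\<phi>\<^sub>1 - \<phi>\<^sub>0)"
    using theI'[OF ex1] unfolding A_def K_const_def Kw1 by auto
  have AK: "0 < A * K_exp \<epsilon> \<rho> \<phi> y" for y using A(1) K_pos by simp
  have w01: "0 < w A y" "w A y < 1" for y
    using AK[of y] unfolding w_def by auto
  have w_cont: "continuous_on {0..1} (w A)"
    unfolding w_def[abs_def] using AK
    by (intro continuous_intros K_cont ballI) (metis add_pos_pos less_irrefl zero_less_one)
  note w_meas = measurable_unit_continuous[OF w_cont]
  \<comment> \<open>The odds w/(1 - w) are A times \<open>K_exp\<close>; their logarithm is s'(w).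
    This is the Euler-Lagrange relation with \<phi> frozen in h.\<close>
  have logit: "ln (w A y) - ln (1 - w A y) = ln A + cumint h y / \<epsilon>" if "y \<in> {0..1}" for y
  proof -
    have "ln (w A y) - ln (1 - w A y) = ln (w A y / (1 - w A y))"
      using w01[of y] by (simp add: ln_divide_pos)
    also have "w A y / (1 - w A y) = A * K_exp \<epsilon> \<rho> \<phi> y"
    proof -
      have "1 - w A y = 1 / (1 + A * K_exp \<epsilon> \<rho> \<phi> y)" using AK[of y] unfolding w_def by (simp add: field_simps)
      then show ?thesis using AK[of y] unfolding w_def by simp
    qed
    also have "ln \<dots> = ln A + cumint h y / \<epsilon>" using A(1) K[OF that] by (simp add: ln_mult)
    finally show ?thesis .
  qed
  define \<psi> where "\<psi> = (\<lambda>x\<in>{0..1}. \<phi>\<^sub>0 + cumint (w A) x / \<epsilon>)"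
  have w_adm: "admissible \<phi>\<^sub>0 \<phi>\<^sub>1 \<epsilon> \<psi> (w A)" and w_G: "G_functional \<phi>\<^sub>0 \<phi>\<^sub>1 \<epsilon> \<rho> \<psi> = ereal (action \<rho> \<psi> (w A))"
    unfolding \<psi>_def using w01 \<rho>
    by (intro admissible_of_continuous_density[OF eps(1) less w_cont _ A(2)]; simp add: less_imp_le)+
  \<comment> \<open>The Bregman divergence of the entropy between u and w.\<close>
  define d where "d x = entropy (u x) - entropy (w A x) - (ln (w A x) - ln (1 - w A x)) * (u x - w A x)" for x
  have u_int: "integrable ?L u" by (rule integrable_unit_bound[OF u(1) AE_abs_le_1[OF u(2)]])
  have w_int: "integrable ?L (w A)" by (rule integrable_unit_continuous[OF w_cont])
  have diff_int: "integrable ?L (\<lambda>y. w A y - u y)" using u_int w_int by simp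
  have hd_int: "integrable ?L (\<lambda>x. h x * cumint (\<lambda>y. w A y - u y) x)"
  proof (rule integrable_unit_mult[OF _ h])
    have "AE x in ?L. \<bar>w A x - u x\<bar> \<le> 1"
      using u(2) by (elim eventually_mono) (use w01 in \<open>smt (verit)\<close>)
    then show "integrable ?L (cumint (\<lambda>y. w A y - u y))"
      using diff_int by (intro integrable_unit_continuous continuous_on_cumint) auto
  qed
  have dW_int: "integrable ?L (\<lambda>x. (w A x - u x) * cumint h x)"
  proof -
    have "AE x in ?L. \<bar>w A x - u x\<bar> \<le> 1"
      using u(2) by (elim eventually_mono) (use w01 in \<open>smt (verit)\<close>)
    then show ?thesis
      using diff_int by (intro integrable_unit_mult[where B=1] integrable_unit_continuous W_cont) auto
  qed
  have lg_int: "integrable ?L (\<lambda>x. (ln (w A x) - ln (1 - w A x)) * (u x - w A x))"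
  proof -
    have "integrable ?L (\<lambda>x. - (ln A * (w A x - u x) + (w A x - u x) * cumint h x / \<epsilon>))"
      using diff_int dW_int by (intro Bochner_Integration.integrable_minus Bochner_Integration.integrable_add
        integrable_mult_right integrable_divide)
    then show ?thesis
      by (rule Bochner_Integration.integrable_cong[THEN iffD1, rotated -1]) (simp_all add: logit algebra_simps diff_divide_distrib)
  qed
  have "action \<rho> \<phi> u \<le> action \<rho> \<psi> (w A)" using le[OF w_adm] G w_G by simp
  moreover have "action \<rho> \<psi> (w A) - action \<rho> \<phi> u = (LINT x|?L. entropy (w A x) - entropy (u x) +
      ((1 - \<rho> x) * \<psi> x - (1 - \<rho> x) * \<phi> x) - (ln (1 + exp (\<psi> x)) - ln (1 + exp (\<phi> x))))"
    unfolding action_def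
    by (subst Bochner_Integration.integral_diff[symmetric])
       (auto intro!: Bochner_Integration.integral_cong Bochner_Integration.integrable_diff
          Bochner_Integration.integrable_add integrable_action_terms[OF \<rho> adm] integrable_action_terms[OF \<rho> w_adm])
  \<comment> \<open>The part concave in \<phi> is replaced by its tangent at \<phi>, with slope h;
    the increment \<psi> - \<phi> is the primitive of w - u divided by \<epsilon>.\<close>
  moreover have "\<dots> \<le> (LINT x|?L. entropy (w A x) - entropy (u x) + h x * cumint (\<lambda>y. w A y - u y) x / \<epsilon>)"
  proof (rule integral_mono)
    fix x assume "x \<in> space ?L"
    then have x: "x \<in> {0..1}" by simp
    define t where "t = exp (\<phi> x) / (1 + exp (\<phi> x))"
    have "cumint (\<lambda>y. w A y - u y) x / \<epsilon> = \<psi> x - \<phi> x"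
      using x \<phi>[OF x] by (simp add: \<psi>_def cumint_diff[OF w_int u_int] diff_divide_distrib)
    then have eqx: "h x * cumint (\<lambda>y. w A y - u y) x / \<epsilon> = h x * (\<psi> x - \<phi> x)"
      by (metis times_divide_eq_right)
    have hx: "h x = (1 - \<rho> x) - t" unfolding h_def t_def by (simp add: field_simps add_pos_pos less_imp_neq[symmetric])
    have "h x * cumint (\<lambda>y. w A y - u y) x / \<epsilon> =
        (1 - \<rho> x) * \<psi> x - (1 - \<rho> x) * \<phi> x - t * (\<psi> x - \<phi> x)"
      unfolding eqx unfolding hx by (simp add: algebra_simps)
    with softplus_tangent[of "\<phi> x" "\<psi> x", folded t_def]
    show "entropy (w A x) - entropy (u x) + ((1 - \<rho> x) * \<psi> x - (1 - \<rho> x) * \<phi> x) -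
        (ln (1 + exp (\<psi> x)) - ln (1 + exp (\<phi> x))) \<le>
        entropy (w A x) - entropy (u x) + h x * cumint (\<lambda>y. w A y - u y) x / \<epsilon>"
      by linarith
  qed (auto intro!: Bochner_Integration.integrable_diff hd_int integrable_divide
          Bochner_Integration.integrable_add integrable_action_terms[OF \<rho> adm] integrable_action_terms[OF \<rho> w_adm])
  moreover have "\<dots> = - (LINT x|?L. d x)"
  proof -
    \<comment> \<open>The boundary term vanishes because u and w have the same mass; for the same
      reason the constant ln A in s'(w) contributes nothing below.\<close>
    have "(LINT x|?L. h x * cumint (\<lambda>y. w A y - u y) x) = - (LINT x|?L. (w A x - u x) * cumint h x)"
      using integral_mult_cumint[OF h_int, of "\<lambda>y. w A y - u y"] u_int w_int u(3) A(2) by simp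
    moreover have "(LINT x|?L. d x) = (LINT x|?L. entropy (u x) - entropy (w A x) +
        (ln A * (w A x - u x) + (w A x - u x) * cumint h x / \<epsilon>))"
      by (intro Bochner_Integration.integral_cong) (simp_all add: d_def logit algebra_simps diff_divide_distrib)
    moreover have "\<dots> = (LINT x|?L. entropy (u x)) - (LINT x|?L. entropy (w A x)) +
        (LINT x|?L. (w A x - u x) * cumint h x) / \<epsilon>"
      using integrable_action_terms[OF \<rho> adm] integrable_action_terms[OF \<rho> w_adm] u_int w_int u(3) A(2) dW_int
      by simp
    ultimately show ?thesis
      using integrable_action_terms[OF \<rho> adm] integrable_action_terms[OF \<rho> w_adm] hd_int by simp
  qed
  ultimately have "(LINT x|?L. d x) \<le> 0" by linarith
  moreover have d_ge: "AE x in ?L. 0 \<le> d x"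
    using u(2)
  proof eventually_elim
    case (elim x)
    then show ?case using entropy_tangent[of "u x" "w A x"] w01[of x] unfolding d_def by linarith
  qed
  moreover have "integrable ?L d"
    unfolding d_def[abs_def] by (intro Bochner_Integration.integrable_diff integrable_action_terms(2)[OF \<rho> adm]
      integrable_action_terms(2)[OF \<rho> w_adm] lg_int)
  ultimately have "AE x in ?L. d x = 0"
    using integral_nonneg_AE[OF d_ge] integral_nonneg_eq_0_iff_AE[of ?L d] d_ge by (meson antisym)
  \<comment> \<open>Zero divergence forces equality, as w lies strictly between 0 and 1 and the
    tangent inequality there is strict.\<close>
  then have "AE x in ?L. u x = w A x"
    using u(2)
  proof eventually_elim
    case (elim x)
    then show ?case using entropy_tangent_strict[of "u x" "w A x"] w01[of x] unfolding d_def by linarith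
  qed
  \<comment> \<open>Densities equal almost everywhere have primitives equal everywhere, so the
    fixed-point identity holds at each point of [0,1].\<close>
  then have "cumint u x = cumint (w A) x" for x by (intro cumint_cong_AE u(1) w_meas)
  then have "K_with \<phi>\<^sub>0 \<epsilon> \<rho> \<phi> A x = \<phi> x" if "x \<in> {0..1}" for x
    using that by (simp add: Kw \<phi>)
  moreover have "\<phi> \<in> extensional {0..1}" using F by (simp add: F_space_def)
  ultimately have "K_map \<phi>\<^sub>0 \<phi>\<^sub>1 \<epsilon> \<rho> \<phi> = \<phi>"
    unfolding K_map_def A_def[symmetric] by (intro extensionalityI[of _ "{0..1}"]) auto
  then show ?thesis using F by (simp add: fixed_points_def)
qed

subsection \<open>Dependence of the action on the density\<close>


lemma admissible_abs_le:
  assumes "admissible \<phi>\<^sub>0 \<phi>\<^sub>1 \<epsilon> \<phi> u" "0 < \<epsilon>" "x \<in> {0..1}"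
  shows "\<bar>\<phi> x\<bar> \<le> \<bar>\<phi>\<^sub>0\<bar> + (\<phi>\<^sub>1 - \<phi>\<^sub>0)"
proof -
  have u: "u \<in> borel_measurable (lebesgue_on {0..1})" "AE x in lebesgue_on {0..1}. 0 \<le> u x \<and> u x \<le> 1"
    "(LINT x|lebesgue_on {0..1}. u x) = \<epsilon> * (\<phi>\<^sub>1 - \<phi>\<^sub>0)" and \<phi>: "\<phi> x = \<phi>\<^sub>0 + cumint u x / \<epsilon>"
    using assms by (auto simp: admissible_def)
  have "\<bar>cumint u x\<bar> \<le> (LINT x|lebesgue_on {0..1}. \<bar>u x\<bar>)"
    by (rule abs_cumint_le[OF integrable_unit_bound[OF u(1) AE_abs_le_1[OF u(2)]]])
  also have "\<dots> = (LINT x|lebesgue_on {0..1}. u x)"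
    using u(1,2) by (intro integral_cong_AE) (auto elim!: eventually_mono)
  finally have "\<bar>cumint u x / \<epsilon>\<bar> \<le> \<phi>\<^sub>1 - \<phi>\<^sub>0"
    using u(3) \<open>0 < \<epsilon>\<close> by (simp add: field_simps)
  then show ?thesis unfolding \<phi> by linarith
qed

text \<open>B bounds |\<phi>|, each entropy is at least -log 2 and [0,1] has measure 1. The bound
  depends on neither u nor \<rho>, so the infimum stays above minus infinity.\<close>

lemma action_ge:
  assumes "admissible \<phi>\<^sub>0 \<phi>\<^sub>1 \<epsilon> \<phi> u" "0 < \<epsilon>" "\<rho> \<in> M_space"
  defines "B \<equiv> \<bar>\<phi>\<^sub>0\<bar> + (\<phi>\<^sub>1 - \<phi>\<^sub>0)"
  shows "- 2 * ln 2 - B - ln (1 + exp B) \<le> action \<rho> \<phi> u"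
proof -
  let ?L = "lebesgue_on {0..1::real}"
  note int = integrable_action_terms[OF assms(3,1)]
  have "(LINT x|?L. - 2 * ln 2 - B - ln (1 + exp B)) \<le> action \<rho> \<phi> u"
    unfolding action_def
  proof (rule integral_mono_AE)
    have u: "AE x in ?L. 0 \<le> u x \<and> u x \<le> 1" using assms(1) by (simp add: admissible_def)
    show "AE x in ?L. - 2 * ln 2 - B - ln (1 + exp B) \<le>
        entropy (\<rho> x) + entropy (u x) + (1 - \<rho> x) * \<phi> x - ln (1 + exp (\<phi> x))"
      using u M_spaceD(2)[OF assms(3)] AE_space
    proof eventually_elim
      case (elim x)
      have \<phi>: "\<bar>\<phi> x\<bar> \<le> B" using elim(3) admissible_abs_le[OF assms(1,2)] by (simp add: B_def)
      have "\<bar>(1 - \<rho> x) * \<phi> x\<bar> \<le> 1 * B" unfolding abs_mult using elim(2) \<phi> by (intro mult_mono) auto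
      moreover have "ln (1 + exp (\<phi> x)) \<le> ln (1 + exp B)"
        using \<phi> by (intro ln_mono) (auto simp: add_pos_pos)
      ultimately show ?case using entropy_ge[of "\<rho> x"] entropy_ge[of "u x"] elim by linarith
    qed
    show "integrable ?L (\<lambda>x. entropy (\<rho> x) + entropy (u x) + (1 - \<rho> x) * \<phi> x - ln (1 + exp (\<phi> x)))"
      by (intro Bochner_Integration.integrable_diff Bochner_Integration.integrable_add int)
  qed (auto intro!: integrable_unit_continuous)
  then show ?thesis by (simp only: LINT_unit_const)
qed

lemma So_functional_finite:
  assumes "\<phi>\<^sub>0 < \<phi>\<^sub>1" "0 < \<epsilon>" "\<epsilon> < 1 / (\<phi>\<^sub>1 - \<phi>\<^sub>0)" "\<rho> \<in> M_space"
  shows "\<bar>So_functional \<phi>\<^sub>0 \<phi>\<^sub>1 \<epsilon> \<rho>\<bar> \<noteq> \<infinity>"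
proof -
  define B where "B = \<bar>\<phi>\<^sub>0\<bar> + (\<phi>\<^sub>1 - \<phi>\<^sub>0)"
  obtain \<phi> u where "admissible \<phi>\<^sub>0 \<phi>\<^sub>1 \<epsilon> \<phi> u" "G_functional \<phi>\<^sub>0 \<phi>\<^sub>1 \<epsilon> \<rho> \<phi> = ereal (action \<rho> \<phi> u)"
    using ex_admissible[OF assms(1-3)] assms(4) by metis
  then have "So_functional \<phi>\<^sub>0 \<phi>\<^sub>1 \<epsilon> \<rho> \<le> ereal (action \<rho> \<phi> u)"
    unfolding So_functional_def by (metis INF_lower admissible_def)
  moreover have "ereal (- 2 * ln 2 - B - ln (1 + exp B)) \<le> So_functional \<phi>\<^sub>0 \<phi>\<^sub>1 \<epsilon> \<rho>"
    unfolding So_functional_def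
  proof (rule INF_greatest)
    fix \<phi> assume F: "\<phi> \<in> F_space \<phi>\<^sub>0 \<phi>\<^sub>1"
    show "ereal (- 2 * ln 2 - B - ln (1 + exp B)) \<le> G_functional \<phi>\<^sub>0 \<phi>\<^sub>1 \<epsilon> \<rho> \<phi>"
    proof (cases "G_functional \<phi>\<^sub>0 \<phi>\<^sub>1 \<epsilon> \<rho> \<phi> = \<infinity>")
      case False
      then obtain u where "admissible \<phi>\<^sub>0 \<phi>\<^sub>1 \<epsilon> \<phi> u" "G_functional \<phi>\<^sub>0 \<phi>\<^sub>1 \<epsilon> \<rho> \<phi> = ereal (action \<rho> \<phi> u)"
        using G_finite_admissible[OF assms(1,2) F] assms(4) by metis
      then show ?thesis using action_ge[OF _ assms(2,4)] by (simp add: B_def)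
    qed simp
  qed
  ultimately show ?thesis by auto
qed

text \<open>Where the value at \<sigma> is infinite the bound is trivial. Elsewhere one u represents
  the values at both \<rho> and \<sigma>, so a comparison of actions passes to the infima.\<close>

lemma So_functional_mono:
  assumes "\<phi>\<^sub>0 < \<phi>\<^sub>1" "0 < \<epsilon>" "\<rho> \<in> M_space" "\<sigma> \<in> M_space"
    and le: "\<And>\<phi> u. admissible \<phi>\<^sub>0 \<phi>\<^sub>1 \<epsilon> \<phi> u \<Longrightarrow> action \<rho> \<phi> u + a \<le> action \<sigma> \<phi> u"
  shows "So_functional \<phi>\<^sub>0 \<phi>\<^sub>1 \<epsilon> \<rho> + ereal a \<le> So_functional \<phi>\<^sub>0 \<phi>\<^sub>1 \<epsilon> \<sigma>"
  unfolding So_functional_def[of _ _ _ \<sigma>]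
proof (rule INF_greatest)
  fix \<phi> assume F: "\<phi> \<in> F_space \<phi>\<^sub>0 \<phi>\<^sub>1"
  show "So_functional \<phi>\<^sub>0 \<phi>\<^sub>1 \<epsilon> \<rho> + ereal a \<le> G_functional \<phi>\<^sub>0 \<phi>\<^sub>1 \<epsilon> \<sigma> \<phi>"
  proof (cases "G_functional \<phi>\<^sub>0 \<phi>\<^sub>1 \<epsilon> \<sigma> \<phi> = \<infinity>")
    case False
    then obtain u where u: "admissible \<phi>\<^sub>0 \<phi>\<^sub>1 \<epsilon> \<phi> u"
      and G: "\<And>\<rho>. \<rho> \<in> M_space \<Longrightarrow> G_functional \<phi>\<^sub>0 \<phi>\<^sub>1 \<epsilon> \<rho> \<phi> = ereal (action \<rho> \<phi> u)"
      using G_finite_admissible[OF assms(1,2) F] by metis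
    have "So_functional \<phi>\<^sub>0 \<phi>\<^sub>1 \<epsilon> \<rho> \<le> ereal (action \<rho> \<phi> u)"
      unfolding So_functional_def using F G[OF assms(3)] by (metis INF_lower)
    then have "So_functional \<phi>\<^sub>0 \<phi>\<^sub>1 \<epsilon> \<rho> + ereal a \<le> ereal (action \<rho> \<phi> u) + ereal a"
      by (rule add_right_mono)
    also have "\<dots> \<le> ereal (action \<sigma> \<phi> u)" using le[OF u] by simp
    finally show ?thesis using G[OF assms(4)] by simp
  qed simp
qed

lemma borel_measurable_clamp_logit [measurable]: "clamp_logit \<delta> \<in> borel_measurable borel"
  unfolding clamp_logit_def[abs_def] Let_def by measurable

lemma M_space_AE_diff:
  assumes "\<rho> \<in> M_space" "\<sigma> \<in> M_space"
  shows "(\<lambda>x. \<sigma> x - \<rho> x) \<in> borel_measurable (lebesgue_on {0..1})"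
    "AE x in lebesgue_on {0..1}. \<bar>\<sigma> x - \<rho> x\<bar> \<le> 1"
    "integrable (lebesgue_on {0..1}) (\<lambda>x. \<sigma> x - \<rho> x)"
proof -
  show 1: "(\<lambda>x. \<sigma> x - \<rho> x) \<in> borel_measurable (lebesgue_on {0..1})"
    using assms[THEN M_spaceD(1)] by measurable
  show 2: "AE x in lebesgue_on {0..1}. \<bar>\<sigma> x - \<rho> x\<bar> \<le> 1"
    using assms[THEN M_spaceD(2)] by eventually_elim auto
  show "integrable (lebesgue_on {0..1}) (\<lambda>x. \<sigma> x - \<rho> x)" by (rule integrable_unit_bound[OF 1 2])
qed

lemma integrable_clamp_logit:
  assumes "0 < \<delta>" "\<delta> < 1/2" "\<rho> \<in> M_space"
  shows "integrable (lebesgue_on {0..1}) (\<lambda>x. clamp_logit \<delta> (\<rho> x))"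
proof (rule integrable_unit_bound[where B="ln (1 - \<delta>) - ln \<delta>"])
  show "(\<lambda>x. clamp_logit \<delta> (\<rho> x)) \<in> borel_measurable (lebesgue_on {0..1})"
    using M_spaceD(1)[OF assms(3)] by measurable
qed (use abs_clamp_logit_le[OF assms(1,2)] in simp)

lemma integrable_clamp_logit_mult:
  assumes "0 < \<delta>" "\<delta> < 1/2" "\<rho> \<in> M_space" "\<sigma> \<in> M_space"
  shows "integrable (lebesgue_on {0..1}) (\<lambda>x. clamp_logit \<delta> (\<rho> x) * (\<sigma> x - \<rho> x))"
  using integrable_unit_mult[OF integrable_clamp_logit[OF assms(1-3)] M_space_AE_diff(1,2)[OF assms(3,4)]]
  by (simp add: mult.commute)

text \<open>Only the entropy of the density and its product with \<phi> change. The first is handled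
  by \<open>entropy_clamp_tangent\<close>, the second by parts, which leaves an error independent of
  \<phi> and u.\<close>

lemma action_perturb:
  assumes less: "\<phi>\<^sub>0 < \<phi>\<^sub>1" and eps: "0 < \<epsilon>" and \<delta>: "0 < \<delta>" "\<delta> < 1/2"
    and \<rho>: "\<rho> \<in> M_space" and \<sigma>: "\<sigma> \<in> M_space" and adm: "admissible \<phi>\<^sub>0 \<phi>\<^sub>1 \<epsilon> \<phi> u"
    and \<eta>: "\<And>x. x \<in> {0..1} \<Longrightarrow> \<bar>cumint (\<lambda>y. \<sigma> y - \<rho> y) x\<bar> \<le> \<eta>"
  shows "action \<rho> \<phi> u + (entropy \<delta> + (LINT x|lebesgue_on {0..1}. clamp_logit \<delta> (\<rho> x) * (\<sigma> x - \<rho> x)) -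
      (\<bar>\<phi>\<^sub>1\<bar> + (\<phi>\<^sub>1 - \<phi>\<^sub>0)) * \<eta>) \<le> action \<sigma> \<phi> u"
proof -
  let ?L = "lebesgue_on {0..1::real}"
  let ?D = "cumint (\<lambda>y. \<sigma> y - \<rho> y)"
  have u: "u \<in> borel_measurable ?L" "AE x in ?L. 0 \<le> u x \<and> u x \<le> 1" "(LINT x|?L. u x) = \<epsilon> * (\<phi>\<^sub>1 - \<phi>\<^sub>0)"
    and \<phi>: "\<And>x. x \<in> {0..1} \<Longrightarrow> \<phi> x = \<phi>\<^sub>0 + cumint u x / \<epsilon>"
    using adm by (auto simp: admissible_def)
  note int = integrable_action_terms[OF \<rho> adm] integrable_action_terms[OF \<sigma> adm]
  note diff = M_space_AE_diff[OF \<rho> \<sigma>]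
  note u_int = integrable_unit_bound[OF u(1) AE_abs_le_1[OF u(2)]]
  note \<phi>_int = integrable_unit_continuous[OF admissible_continuous[OF adm]]
  have "action \<sigma> \<phi> u - action \<rho> \<phi> u = (LINT x|?L. (entropy (\<sigma> x) - entropy (\<rho> x)) - (\<sigma> x - \<rho> x) * \<phi> x)"
    unfolding action_def
    by (subst Bochner_Integration.integral_diff[symmetric];
        (intro Bochner_Integration.integrable_diff Bochner_Integration.integrable_add int)?)
       (simp add: algebra_simps)
  also have "\<dots> = (LINT x|?L. entropy (\<sigma> x) - entropy (\<rho> x)) - (LINT x|?L. (\<sigma> x - \<rho> x) * \<phi> x)"
    using int by (intro Bochner_Integration.integral_diff Bochner_Integration.integrable_diff
      integrable_unit_mult[OF \<phi>_int diff(1,2)])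
  finally have eq: "action \<sigma> \<phi> u - action \<rho> \<phi> u =
    (LINT x|?L. entropy (\<sigma> x) - entropy (\<rho> x)) - (LINT x|?L. (\<sigma> x - \<rho> x) * \<phi> x)" .
  have ent: "entropy \<delta> + (LINT x|?L. clamp_logit \<delta> (\<rho> x) * (\<sigma> x - \<rho> x)) \<le> (LINT x|?L. entropy (\<sigma> x) - entropy (\<rho> x))"
  proof -
    note cl = integrable_clamp_logit_mult[OF \<delta> \<rho> \<sigma>]
    have c: "integrable ?L (\<lambda>x. entropy \<delta>)" by (intro integrable_unit_continuous) simp
    have "(LINT x|?L. entropy \<delta> + clamp_logit \<delta> (\<rho> x) * (\<sigma> x - \<rho> x)) \<le> (LINT x|?L. entropy (\<sigma> x) - entropy (\<rho> x))"
    proof (rule integral_mono_AE)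
      show "AE x in ?L. entropy \<delta> + clamp_logit \<delta> (\<rho> x) * (\<sigma> x - \<rho> x) \<le> entropy (\<sigma> x) - entropy (\<rho> x)"
        using M_spaceD(2)[OF \<rho>] M_spaceD(2)[OF \<sigma>]
        by eventually_elim (use entropy_clamp_tangent[OF \<delta>] in \<open>smt (verit)\<close>)
    qed (intro Bochner_Integration.integrable_add Bochner_Integration.integrable_diff cl c int)+
    then show ?thesis by (simp only: Bochner_Integration.integral_add[OF c cl] LINT_unit_const)
  qed
  \<comment> \<open>With D the primitive of \<sigma> - \<rho>, the integral is
    \<open>\<phi>\<^sub>1\<close> D(1) minus the integral of u D divided by \<epsilon>. As u has
    mass \<epsilon> (\<open>\<phi>\<^sub>1 - \<phi>\<^sub>0\<close>), the factor \<epsilon>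
    cancels.\<close>
  have "\<bar>LINT x|?L. (\<sigma> x - \<rho> x) * \<phi> x\<bar> \<le> (\<bar>\<phi>\<^sub>1\<bar> + (\<phi>\<^sub>1 - \<phi>\<^sub>0)) * \<eta>"
  proof -
    have D_cont: "continuous_on {0..1} ?D" by (rule continuous_on_cumint[OF diff(1,2)])
    have uD: "integrable ?L (\<lambda>x. u x * ?D x)"
      by (rule integrable_unit_mult[OF integrable_unit_continuous[OF D_cont] u(1) AE_abs_le_1[OF u(2)]])
    have Du: "integrable ?L (\<lambda>x. (\<sigma> x - \<rho> x) * cumint u x)"
      by (rule integrable_unit_mult[OF integrable_unit_continuous[OF
        continuous_on_cumint[OF u(1) AE_abs_le_1[OF u(2)]]] diff(1,2)])
    have "(LINT x|?L. (\<sigma> x - \<rho> x) * \<phi> x) = (LINT x|?L. (\<sigma> x - \<rho> x) * \<phi>\<^sub>0 + (\<sigma> x - \<rho> x) * cumint u x / \<epsilon>)"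
      by (intro Bochner_Integration.integral_cong) (simp_all add: \<phi> distrib_left)
    also have "\<dots> = ?D 1 * \<phi>\<^sub>0 + (LINT x|?L. (\<sigma> x - \<rho> x) * cumint u x) / \<epsilon>"
      unfolding cumint_1 using diff(3) Du by simp
    also have "(LINT x|?L. (\<sigma> x - \<rho> x) * cumint u x) = ?D 1 * (\<epsilon> * (\<phi>\<^sub>1 - \<phi>\<^sub>0)) - (LINT x|?L. u x * ?D x)"
      unfolding cumint_1 using integral_mult_cumint[OF diff(3) u_int] u(3) by simp
    also have "?D 1 * \<phi>\<^sub>0 + (?D 1 * (\<epsilon> * (\<phi>\<^sub>1 - \<phi>\<^sub>0)) - (LINT x|?L. u x * ?D x)) / \<epsilon> =
        \<phi>\<^sub>1 * ?D 1 - (LINT x|?L. u x * ?D x) / \<epsilon>"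
      using eps by (simp add: field_simps)
    finally have e: "(LINT x|?L. (\<sigma> x - \<rho> x) * \<phi> x) = \<phi>\<^sub>1 * ?D 1 - (LINT x|?L. u x * ?D x) / \<epsilon>" .
    have "\<bar>LINT x|?L. u x * ?D x\<bar> \<le> (LINT x|?L. \<bar>u x * ?D x\<bar>)" by (rule integral_abs_bound)
    also have "\<dots> \<le> (LINT x|?L. u x * \<eta>)"
    proof (rule integral_mono_AE)
      show "AE x in ?L. \<bar>u x * ?D x\<bar> \<le> u x * \<eta>"
        using u(2) AE_space by eventually_elim (use \<eta> in \<open>auto simp: abs_mult intro!: mult_left_mono\<close>)
    qed (use uD u_int in auto)
    also have "\<dots> = \<epsilon> * (\<phi>\<^sub>1 - \<phi>\<^sub>0) * \<eta>" using u(3) by simp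
    finally have "\<bar>(LINT x|?L. u x * ?D x) / \<epsilon>\<bar> \<le> (\<phi>\<^sub>1 - \<phi>\<^sub>0) * \<eta>"
      using eps by (simp add: field_simps)
    moreover have "\<bar>\<phi>\<^sub>1 * ?D 1\<bar> \<le> \<bar>\<phi>\<^sub>1\<bar> * \<eta>" unfolding abs_mult using \<eta>[of 1] by (intro mult_left_mono) auto
    ultimately show ?thesis unfolding e distrib_right by linarith
  qed
  with eq ent show ?thesis by linarith
qed


lemma So_functional_perturb:
  assumes "\<phi>\<^sub>0 < \<phi>\<^sub>1" "0 < \<epsilon>" "0 < \<delta>" "\<delta> < 1/2" "\<rho> \<in> M_space" "\<sigma> \<in> M_space"
    and "\<And>x. x \<in> {0..1} \<Longrightarrow> \<bar>cumint (\<lambda>y. \<sigma> y - \<rho> y) x\<bar> \<le> \<eta>"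
  shows "So_functional \<phi>\<^sub>0 \<phi>\<^sub>1 \<epsilon> \<rho> + ereal (entropy \<delta> +
      (LINT x|lebesgue_on {0..1}. clamp_logit \<delta> (\<rho> x) * (\<sigma> x - \<rho> x)) - (\<bar>\<phi>\<^sub>1\<bar> + (\<phi>\<^sub>1 - \<phi>\<^sub>0)) * \<eta>)
    \<le> So_functional \<phi>\<^sub>0 \<phi>\<^sub>1 \<epsilon> \<sigma>"
  using assms by (intro So_functional_mono action_perturb) auto

section \<open>Weak* neighbourhoods and lower semicontinuity\<close>

lemma topspace_M_topology: "topspace M_topology = M_space"
  unfolding M_topology_def weak_star_def M_space_def
  by (auto simp: topspace_pullback_topology)

text \<open>Seen through the pullback, the functional is a coordinate projection of the product
  space.\<close>

lemma continuous_map_M_topology: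
  assumes "integrable (lebesgue_on {0..1}) g"
  shows "continuous_map M_topology euclideanreal (\<lambda>\<rho>. LINT x|lebesgue_on {0..1}. \<rho> x * g x)"
proof -
  have g: "g \<in> L1_space" using assms by (simp add: L1_space_def)
  have "continuous_map (product_topology (\<lambda>_. euclideanreal) L1_space) euclideanreal (\<lambda>f. f g)"
    by (rule continuous_map_product_projection[OF g])
  then have "continuous_map weak_star euclideanreal
      ((\<lambda>f. f g) \<circ> (\<lambda>\<rho>. \<lambda>g\<in>L1_space. LINT x|lebesgue_on {0..1}. \<rho> x * g x))"
    unfolding weak_star_def by (rule continuous_map_pullback)
  then show ?thesis
    unfolding M_topology_def using g by (intro continuous_map_from_subtopology) (simp add: o_def)
qed

lemma openin_M_topology_nbhd:
  assumes "finite \<G>" "\<And>g. g \<in> \<G> \<Longrightarrow> integrable (lebesgue_on {0..1}) g"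
  shows "openin M_topology {\<sigma> \<in> M_space. \<forall>g\<in>\<G>. \<bar>(LINT x|lebesgue_on {0..1}. \<sigma> x * g x) -
      (LINT x|lebesgue_on {0..1}. \<rho> x * g x)\<bar> < e}"
  using assms
proof (induction \<G>)
  case empty
  then show ?case using openin_topspace[of M_topology] by (simp add: topspace_M_topology)
next
  case (insert g \<G>)
  have "openin M_topology {\<sigma> \<in> topspace M_topology. (LINT x|lebesgue_on {0..1}. \<sigma> x * g x) \<in>
      ball (LINT x|lebesgue_on {0..1}. \<rho> x * g x) e}"
    by (rule openin_continuous_map_preimage[OF continuous_map_M_topology]) (use insert in auto)
  from openin_Int[OF this insert.IH] insert.prems
  show ?case
    by (simp add: topspace_M_topology dist_real_def abs_minus_commute Int_def conj_ac cong: conj_cong)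
qed

text \<open>The primitive is 1-Lipschitz, and the grid point just left of x is at distance at most
  1/N \<le> \<eta>.\<close>

lemma cumint_le_of_grid:
  assumes f: "f \<in> borel_measurable (lebesgue_on {0..1})" "AE x in lebesgue_on {0..1}. \<bar>f x\<bar> \<le> 1"
    and N: "0 < N" "1 / real N \<le> \<eta>" and x: "x \<in> {0..1}"
    and grid: "\<And>k. k \<le> N \<Longrightarrow> \<bar>cumint f (real k / real N)\<bar> \<le> \<eta>"
  shows "\<bar>cumint f x\<bar> \<le> 2 * \<eta>"
proof -
  define k where "k = nat \<lfloor>x * N\<rfloor>"
  have k: "real k \<le> x * N" "x * N < real k + 1"
    using x by (auto simp: k_def)
  have "x * N \<le> N" using x by (simp add: mult_left_le_one_le)
  then have kN: "k \<le> N" using k(1) by linarith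
  have "\<bar>cumint f x - cumint f (real k / real N)\<bar> \<le> 1 * \<bar>x - real k / real N\<bar>"
    by (rule cumint_lipschitz[OF f x]) (use kN N in auto)
  also have "x - real k / real N = (x * N - k) / N" using N(1) by (simp add: field_simps)
  also have "1 * \<bar>\<dots>\<bar> \<le> 1 / N" using k N(1) by (simp add: divide_right_mono)
  finally show ?thesis using N(2) grid[OF kN] by linarith
qed

lemma So_functional_lsc:
  assumes "\<phi>\<^sub>0 < \<phi>\<^sub>1" "0 < \<epsilon>" "\<epsilon> < 1 / (\<phi>\<^sub>1 - \<phi>\<^sub>0)"
  shows "lower_semicontinuous_map M_topology (So_functional \<phi>\<^sub>0 \<phi>\<^sub>1 \<epsilon>)"
  unfolding lower_semicontinuous_map_def
proof
  fix c
  let ?So = "So_functional \<phi>\<^sub>0 \<phi>\<^sub>1 \<epsilon>" and ?L = "lebesgue_on {0..1::real}"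
  show "openin M_topology {\<rho> \<in> topspace M_topology. c < ?So \<rho>}"
  proof (subst openin_subopen, safe)
    fix \<rho> assume "\<rho> \<in> topspace M_topology" and c: "c < ?So \<rho>"
    then have \<rho>: "\<rho> \<in> M_space" by (simp add: topspace_M_topology)
    obtain r where r: "?So \<rho> = ereal r" using So_functional_finite[OF assms \<rho>] by auto
    \<comment> \<open>The level c is an extended real; a real level strictly between it and the
      value r makes the gap a real number.\<close>
    obtain c' where c': "c < ereal c'" "c' < r" using ereal_dense2[OF c] unfolding r by auto
    \<comment> \<open>A third of the gap for each of three errors: s(\<delta>), the pairing with the
      clamped logit, and the term C (2 \<eta>) from the primitive.\<close>
    define e where "e = (r - c') / 3"
    have e: "0 < e" using c' by (simp add: e_def)
    obtain \<delta> where \<delta>: "\<bar>entropy \<delta>\<bar> < e" "0 < \<delta>" "\<delta> < 1/2"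
      using ex_small_entropy[of "e"] e by auto
    define C where "C = \<bar>\<phi>\<^sub>1\<bar> + (\<phi>\<^sub>1 - \<phi>\<^sub>0)"
    have C: "0 < C" using assms(1) by (simp add: C_def)
    define \<eta> where "\<eta> = min e (e / (2 * C))"
    have \<eta>: "0 < \<eta>" "\<eta> \<le> e" "C * (2 * \<eta>) \<le> e" using e C by (auto simp: \<eta>_def min_def field_simps)
    obtain N where N: "0 < N" "1 / real N < \<eta>" using nat_approx_posE[OF \<eta>(1)] by (metis of_nat_Suc zero_less_Suc)
    \<comment> \<open>Finitely many test functions: the clamped logit of the centre \<rho>, and the
      indicators whose pairings are the grid values of the primitive.\<close>
    define \<G> where "\<G> = insert (\<lambda>x. clamp_logit \<delta> (\<rho> x)) ((\<lambda>k. indicator {0..real k / real N}) ` {..N})"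
    have \<G>: "finite \<G>" "\<And>g. g \<in> \<G> \<Longrightarrow> integrable ?L g"
      using integrable_clamp_logit[OF \<delta>(2,3) \<rho>]
      by (auto simp: \<G>_def intro!: integrable_unit_bound[where B=1, OF measurable_indicator_unit(1)])
    define V where "V = {\<sigma> \<in> M_space. \<forall>g\<in>\<G>. \<bar>(LINT x|?L. \<sigma> x * g x) - (LINT x|?L. \<rho> x * g x)\<bar> < \<eta>}"
    have "openin M_topology V" unfolding V_def by (rule openin_M_topology_nbhd[OF \<G>])
    moreover have "\<rho> \<in> V" using \<rho> \<eta> by (simp add: V_def)
    moreover have "V \<subseteq> {\<rho> \<in> topspace M_topology. c < ?So \<rho>}"
    proof safe
      fix \<sigma> assume V: "\<sigma> \<in> V"
      then have \<sigma>: "\<sigma> \<in> M_space" by (simp add: V_def)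
      then show "\<sigma> \<in> topspace M_topology" by (simp add: topspace_M_topology)
      note diff = M_space_AE_diff[OF \<rho> \<sigma>]
      have close: "\<bar>LINT x|?L. g x * (\<sigma> x - \<rho> x)\<bar> < \<eta>" if "g \<in> \<G>" for g
      proof -
        have *: "integrable ?L (\<lambda>x. \<sigma> x * g x)" "integrable ?L (\<lambda>x. \<rho> x * g x)"
          by (rule integrable_unit_mult[OF \<G>(2)[OF that] M_spaceD(1) AE_abs_le_1[OF M_spaceD(2)]];
              rule \<rho> \<sigma>)+
        have "(LINT x|?L. g x * (\<sigma> x - \<rho> x)) = (LINT x|?L. \<sigma> x * g x - \<rho> x * g x)"
          by (simp add: algebra_simps)
        then show ?thesis using V that by (simp add: V_def *)
      qed
      have "\<bar>cumint (\<lambda>y. \<sigma> y - \<rho> y) (real k / real N)\<bar> \<le> \<eta>" if "k \<le> N" for k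
        unfolding cumint_def using that by (intro less_imp_le close) (auto simp: \<G>_def)
      then have "\<bar>cumint (\<lambda>y. \<sigma> y - \<rho> y) x\<bar> \<le> 2 * \<eta>" if "x \<in> {0..1}" for x
        using cumint_le_of_grid[OF diff(1,2) N(1) less_imp_le[OF N(2)] that] by blast
      from So_functional_perturb[OF assms(1,2) \<delta>(2,3) \<rho> \<sigma> this]
      have le: "ereal (r + (entropy \<delta> + (LINT x|?L. clamp_logit \<delta> (\<rho> x) * (\<sigma> x - \<rho> x)) - C * (2 * \<eta>))) \<le> ?So \<sigma>"
        by (simp add: r C_def)
      have "\<bar>LINT x|?L. clamp_logit \<delta> (\<rho> x) * (\<sigma> x - \<rho> x)\<bar> < \<eta>"
        by (rule close) (simp add: \<G>_def)
      then have "c' < r + (entropy \<delta> + (LINT x|?L. clamp_logit \<delta> (\<rho> x) * (\<sigma> x - \<rho> x)) - C * (2 * \<eta>))"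
        using \<eta> \<delta>(1) e_def by (simp add: field_simps)
      then show "c < ?So \<sigma>" using c'(1) le by (meson less_ereal.simps(1) less_trans order_less_le_trans)
    qed
    ultimately show "\<exists>T. openin M_topology T \<and> \<rho> \<in> T \<and> T \<subseteq> {\<rho> \<in> topspace M_topology. c < ?So \<rho>}" by blast
  qed
qed

text \<open>Allowing infinite \<open>d\<close>, where the difference is constant, avoids any analysis of \<open>rho_bar\<close>.\<close>

lemma lower_semicontinuous_map_diff_const:
  assumes lsc: "lower_semicontinuous_map X F" and fin: "\<And>x. x \<in> topspace X \<Longrightarrow> \<bar>F x\<bar> \<noteq> \<infinity>"
  shows "lower_semicontinuous_map X (\<lambda>x. F x - d)"
  unfolding lower_semicontinuous_map_def
proof
  fix c
  show "openin X {x \<in> topspace X. c < F x - d}"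
  proof (cases d)
    case (real r)
    have "{x \<in> topspace X. c < F x - d} = {x \<in> topspace X. c + d < F x}"
      using real by (auto simp: ereal_less_minus)
    then show ?thesis using lsc by (simp add: lower_semicontinuous_map_def)
  next
    case PInf
    have "F x - d = - \<infinity>" if "x \<in> topspace X" for x using PInf fin[OF that] by (cases "F x") auto
    then have "{x \<in> topspace X. c < F x - d} = {}" by auto
    then show ?thesis by (metis openin_empty)
  next
    case MInf
    have "{x \<in> topspace X. c < F x - d} = (if c = \<infinity> then {} else topspace X)" using MInf fin by auto
    then show ?thesis by simp
  qed
qed

section \<open>Continuity under strong L1 convergence\<close>

lemma So_functional_L1_continuous:
  assumes "\<phi>\<^sub>0 < \<phi>\<^sub>1" "0 < \<epsilon>" "\<epsilon> < 1 / (\<phi>\<^sub>1 - \<phi>\<^sub>0)" and \<rho>: "\<rho> \<in> M_space" and \<rho>n: "\<And>n. \<rho>n n \<in> M_space"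
    and lim: "(\<lambda>n::nat. LINT x|lebesgue_on {0..1}. \<bar>\<rho>n n x - \<rho> x\<bar>) \<longlonglongrightarrow> 0"
  shows "(\<lambda>n. So_functional \<phi>\<^sub>0 \<phi>\<^sub>1 \<epsilon> (\<rho>n n)) \<longlonglongrightarrow> So_functional \<phi>\<^sub>0 \<phi>\<^sub>1 \<epsilon> \<rho>"
proof -
  let ?L = "lebesgue_on {0..1::real}"
  define R where "R \<sigma> = real_of_ereal (So_functional \<phi>\<^sub>0 \<phi>\<^sub>1 \<epsilon> \<sigma>)" for \<sigma>
  have R: "So_functional \<phi>\<^sub>0 \<phi>\<^sub>1 \<epsilon> \<sigma> = ereal (R \<sigma>)" if "\<sigma> \<in> M_space" for \<sigma>
    using So_functional_finite[OF assms(1-3) that] by (simp add: R_def ereal_real)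
  define C where "C = \<bar>\<phi>\<^sub>1\<bar> + (\<phi>\<^sub>1 - \<phi>\<^sub>0)"
  \<comment> \<open>The L1 distance bounds the primitive of \<sigma> - \<rho> and, times the bound
    of the clamped logit, the pairing. The result is stated for arbitrary pairs so that exchanging
    \<rho> and \<sigma> gives the other inequality.\<close>
  have half: "R \<rho> - R \<sigma> \<le> (ln (1 - \<delta>) - ln \<delta> + C) * (LINT x|?L. \<bar>\<sigma> x - \<rho> x\<bar>) - entropy \<delta>"
    if "\<rho> \<in> M_space" "\<sigma> \<in> M_space" "0 < \<delta>" "\<delta> < 1/2" for \<rho> \<sigma> \<delta>
  proof -
    note diff = M_space_AE_diff[OF that(1,2)]
    have "\<bar>LINT x|?L. clamp_logit \<delta> (\<rho> x) * (\<sigma> x - \<rho> x)\<bar> \<le> (LINT x|?L. \<bar>clamp_logit \<delta> (\<rho> x) * (\<sigma> x - \<rho> x)\<bar>)"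
      by (rule integral_abs_bound)
    also have "\<dots> \<le> (LINT x|?L. (ln (1 - \<delta>) - ln \<delta>) * \<bar>\<sigma> x - \<rho> x\<bar>)"
    proof (rule integral_mono)
      show "\<bar>clamp_logit \<delta> (\<rho> x) * (\<sigma> x - \<rho> x)\<bar> \<le> (ln (1 - \<delta>) - ln \<delta>) * \<bar>\<sigma> x - \<rho> x\<bar>" for x
        unfolding abs_mult by (rule mult_right_mono[OF abs_clamp_logit_le[OF that(3,4)]]) simp
    qed (intro Bochner_Integration.integrable_abs integrable_mult_right
        integrable_clamp_logit_mult[OF that(3,4,1,2)] diff(3))+
    finally have "- ((ln (1 - \<delta>) - ln \<delta>) * (LINT x|?L. \<bar>\<sigma> x - \<rho> x\<bar>)) \<le> (LINT x|?L. clamp_logit \<delta> (\<rho> x) * (\<sigma> x - \<rho> x))"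
      by simp
    moreover have "R \<rho> + (entropy \<delta> + (LINT x|?L. clamp_logit \<delta> (\<rho> x) * (\<sigma> x - \<rho> x)) -
        C * (LINT x|?L. \<bar>\<sigma> x - \<rho> x\<bar>)) \<le> R \<sigma>"
      using So_functional_perturb[OF assms(1,2) that(3,4,1,2) abs_cumint_le[OF diff(3)]] that
      by (simp add: R C_def)
    ultimately show ?thesis by (simp add: distrib_right)
  qed
  have "(\<lambda>n. R (\<rho>n n)) \<longlonglongrightarrow> R \<rho>"
  proof (rule LIMSEQ_I)
    fix e :: real assume e: "0 < e"
    \<comment> \<open>First \<delta> is fixed, then n is taken large: the constant in front of the
      L1 distance blows up as \<delta> tends to 0.\<close>
    obtain \<delta> where \<delta>: "\<bar>entropy \<delta>\<bar> < e / 2" "0 < \<delta>" "\<delta> < 1/2"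
      using ex_small_entropy[of "e / 2"] e by auto
    have "(\<lambda>n. (ln (1 - \<delta>) - ln \<delta> + C) * (LINT x|?L. \<bar>\<rho>n n x - \<rho> x\<bar>)) \<longlonglongrightarrow> (ln (1 - \<delta>) - ln \<delta> + C) * 0"
      by (intro tendsto_intros lim)
    from LIMSEQ_D[OF this, of "e / 2"] e
    obtain N where N: "\<forall>n\<ge>N. norm ((ln (1 - \<delta>) - ln \<delta> + C) * (LINT x|?L. \<bar>\<rho>n n x - \<rho> x\<bar>)
        - (ln (1 - \<delta>) - ln \<delta> + C) * 0) < e / 2"
      by auto
    show "\<exists>N. \<forall>n\<ge>N. norm (R (\<rho>n n) - R \<rho>) < e"
    proof (intro exI allI impI)
      fix n assume "n \<ge> N"
      define p where "p = (ln (1 - \<delta>) - ln \<delta> + C) * (LINT x|?L. \<bar>\<rho>n n x - \<rho> x\<bar>)"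
      have "\<bar>p\<bar> < e / 2"
        using N \<open>n \<ge> N\<close> unfolding p_def by (simp only: mult_zero_right diff_0_right real_norm_def)
      moreover have "(LINT x|?L. \<bar>\<rho>n n x - \<rho> x\<bar>) = (LINT x|?L. \<bar>\<rho> x - \<rho>n n x\<bar>)"
        by (simp only: abs_minus_commute)
      then have "R (\<rho>n n) - R \<rho> \<le> p - entropy \<delta>"
        unfolding p_def by (simp only: half[OF \<rho>n[of n] \<rho> \<delta>(2,3)])
      moreover have "R \<rho> - R (\<rho>n n) \<le> p - entropy \<delta>"
        unfolding p_def by (rule half[OF \<rho> \<rho>n[of n] \<delta>(2,3)])
      ultimately show "norm (R (\<rho>n n) - R \<rho>) < e"
        using \<delta>(1) unfolding real_norm_def by linarith
    qed
  qed
  then show ?thesis using \<rho> \<rho>n by (simp add: R)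
qed

theorem theorem2p2:
  fixes \<phi>\<^sub>0 \<phi>\<^sub>1 \<epsilon> :: real and \<rho> :: "real \<Rightarrow> real"
  assumes "\<phi>\<^sub>0 < \<phi>\<^sub>1" and "0 < \<epsilon>" and "\<epsilon> < 1 / (\<phi>\<^sub>1 - \<phi>\<^sub>0)" and "\<rho> \<in> M_space"
  shows "minimizers \<phi>\<^sub>0 \<phi>\<^sub>1 \<epsilon> \<rho> \<subseteq> fixed_points \<phi>\<^sub>0 \<phi>\<^sub>1 \<epsilon> \<rho> \<and>
    lower_semicontinuous_map M_topology (S_functional \<phi>\<^sub>0 \<phi>\<^sub>1 \<epsilon>) \<and>
    (\<forall>\<rho>n :: nat \<Rightarrow> real \<Rightarrow> real. (\<forall>n. \<rho>n n \<in> M_space) \<longrightarrow>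
       (\<lambda>n. LINT x|lebesgue_on {0..1}. \<bar>\<rho>n n x - \<rho> x\<bar>) \<longlonglongrightarrow> 0 \<longrightarrow>
       (\<lambda>n. S_functional \<phi>\<^sub>0 \<phi>\<^sub>1 \<epsilon> (\<rho>n n)) \<longlonglongrightarrow> S_functional \<phi>\<^sub>0 \<phi>\<^sub>1 \<epsilon> \<rho>)"
proof (intro conjI allI impI)
  note finite = So_functional_finite[OF assms(1-3)]
  show "minimizers \<phi>\<^sub>0 \<phi>\<^sub>1 \<epsilon> \<rho> \<subseteq> fixed_points \<phi>\<^sub>0 \<phi>\<^sub>1 \<epsilon> \<rho>"
    using minimizer_is_fixed_point[OF assms] by blast
  show "lower_semicontinuous_map M_topology (S_functional \<phi>\<^sub>0 \<phi>\<^sub>1 \<epsilon>)"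
    unfolding S_functional_def[abs_def] using finite
    by (intro lower_semicontinuous_map_diff_const So_functional_lsc assms) (simp add: topspace_M_topology)
  fix \<rho>n :: "nat \<Rightarrow> real \<Rightarrow> real"
  assume \<rho>n: "\<forall>n. \<rho>n n \<in> M_space" and lim: "(\<lambda>n. LINT x|lebesgue_on {0..1}. \<bar>\<rho>n n x - \<rho> x\<bar>) \<longlonglongrightarrow> 0"
  have "(\<lambda>n. So_functional \<phi>\<^sub>0 \<phi>\<^sub>1 \<epsilon> (\<rho>n n)) \<longlonglongrightarrow> So_functional \<phi>\<^sub>0 \<phi>\<^sub>1 \<epsilon> \<rho>"
    using So_functional_L1_continuous[OF assms _ lim] \<rho>n by blast
  \<comment> \<open>The limit is finite, so subtracting a constant, whatever extended value it has,
    is continuous there.\<close>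
  then show "(\<lambda>n. S_functional \<phi>\<^sub>0 \<phi>\<^sub>1 \<epsilon> (\<rho>n n)) \<longlonglongrightarrow> S_functional \<phi>\<^sub>0 \<phi>\<^sub>1 \<epsilon> \<rho>"
    unfolding S_functional_def using finite[OF assms(4)]
    by (intro tendsto_diff_ereal_general tendsto_const) auto
qed

end
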